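(* The proof system $\mathsf{C}(\ast,\mathrel{-\!\!\ast})$ is sound and complete for $\mathrm{SL}(\ast,\mathrel{-\!\!\ast})$: a formula $\varphi$ of $\mathrm{SL}(\ast,\mathrel{-\!\!\ast})$ is valid if and only if $\vdash_{\mathsf{C}(\ast,\mathrel{-\!\!\ast})}\varphi$.
   Context: Syntax of $\mathrm{SL}(\ast,\mathrel{-\!\!\ast})$: fix a countably infinite set $\mathrm{PVAR}$ of program variables and a countably infinite set $\mathrm{LOC}$ of locations. Formulae are given by $\varphi ::= x = y \mid x \hookrightarrow y \mid \mathrm{emp} \mid \neg\varphi \mid \varphi\wedge\varphi \mid \varphi \ast \varphi \mid \varphi \mathrel{-\!\!\ast} \varphi$ with $x,y\in\mathrm{PVAR}$; $\vee,\Rightarrow,\Leftrightarrow$ are the usual abbreviations. Semantics: a memory state is a pair $(s,h)$ with $s:\mathrm{PVAR}\to\mathrm{LOC}$ and $h$ a partial function $\mathrm{LOC}\to\mathrm{LOC}$ with finite domain $\mathrm{dom}(h)$. Heaps $h_1,h_2$ are disjoint if $\mathrm{dom}(h_1)\cap\mathrm{dom}(h_2)=\emptyset$, and then $h_1+h_2$ is their union. $(s,h)\models x=y$ iff $s(x)=s(y)$; $(s,h)\models\mathrm{emp}$ iff $\mathrm{dom}(h)=\emptyset$; $(s,h)\models x\hookrightarrow y$ iff $s(x)\in\mathrm{dom}(h)$ and $h(s(x))=s(y)$; Boolean connectives as usual; $(s,h)\models\varphi_1\ast\varphi_2$ iff there are disjoint $h_1,h_2$ with $h=h_1+h_2$,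 $(s,h_1)\models\varphi_1$ and $(s,h_2)\models\varphi_2$; $(s,h)\models\varphi_1\mathrel{-\!\!\ast}\varphi_2$ iff for every heap $h_1$ disjoint from $h$ with $(s,h_1)\models\varphi_1$, $(s,h+h_1)\models\varphi_2$. A formula is valid if every memory state satisfies it. Abbreviations: $\bot := \neg(x=x)$, $\top:=\neg\bot$; $\varphi \mathrel{-\!\!\circledast} \psi := \neg(\varphi\mathrel{-\!\!\ast}\neg\psi)$; $\mathrm{alloc}(x) := (x\hookrightarrow x)\mathrel{-\!\!\ast}\bot$; $\mathrm{size}\ge 0 := \top$, $\mathrm{size}\ge 1 := \neg\mathrm{emp}$, $\mathrm{size}\ge\beta := \neg\mathrm{emp}\ast\mathrm{size}\ge\beta-1$ for $\beta\ge2$; $\mathrm{size}=\beta := \mathrm{size}\ge\beta\wedge\neg\,\mathrm{size}\ge\beta+1$; $a\dot- b=\max(0,a-b)$. The system $\mathsf{C}(\ast,\mathrel{-\!\!\ast})$ (derivability is the least set containing all instances of the axiom schemata, metavariables ranging over formulae, variables, naturals and finite sets $X\subseteq\mathrm{PVAR}$, and closed under the rules) contains all axiom schemata of classical propositional calculus and modus ponens, together with: (1) $x=x$; (2) $\varphi\wedge x=y\Rightarrow\varphi'$, where $\varphi'$ is obtained from $\varphi$ by replacing every occurrence of $y$ with $x$; (3) $x\hookrightarrow y\Rightarrow\mathrm{alloc}(x)$; (4) $(x\hookrightarrow y\wedge x\hookrightarrow z)\Rightarrow y=z$; (5) $(\varphi\ast\psi)\Leftrightarrow(\psi\ast\varphi)$;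 (6) $((\varphi\ast\psi)\ast\chi)\Leftrightarrow(\varphi\ast(\psi\ast\chi))$; (7) $\varphi\Leftrightarrow(\varphi\ast\mathrm{emp})$; (8) $(\mathrm{alloc}(x)\ast\mathrm{alloc}(x))\Leftrightarrow\bot$; (9) $(\xi\ast\top)\Rightarrow\xi$ for $\xi\in\{\neg\mathrm{emp},\ x=y,\ \neg(x=y),\ x\hookrightarrow y\}$; (10) $(\neg\mathrm{alloc}(x)\ast\neg\mathrm{alloc}(x))\Rightarrow\neg\mathrm{alloc}(x)$; (11) $((\mathrm{alloc}(x)\wedge\neg x\hookrightarrow y)\ast\top)\Rightarrow\neg x\hookrightarrow y$; (12) $\mathrm{alloc}(x)\Rightarrow((\mathrm{alloc}(x)\wedge\mathrm{size}=1)\ast\top)$; (13) $\neg\mathrm{emp}\Rightarrow(\mathrm{size}=1\ast\top)$; (14) $(\neg\,\mathrm{size}\ge\beta_1\ast\neg\,\mathrm{size}\ge\beta_2)\Rightarrow\neg\,\mathrm{size}\ge\beta_1+\beta_2\dot-1$; (15) $(\mathrm{alloc}(x)\wedge\mathrm{alloc}(y)\wedge\neg(x=y))\Rightarrow\mathrm{size}\ge2$; (16) $(\mathrm{size}=1\wedge\bigwedge_{x\in X}\neg\mathrm{alloc}(x))\mathrel{-\!\!\circledast}\top$; (17) $\neg\mathrm{alloc}(x)\Rightarrow((x\hookrightarrow y\wedge\mathrm{size}=1)\mathrel{-\!\!\circledast}\top)$; (18) $\neg\mathrm{alloc}(x)\Rightarrow((\mathrm{alloc}(x)\wedge\mathrm{size}=1\wedge\bigwedge_{y\in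 X}\neg x\hookrightarrow y)\mathrel{-\!\!\circledast}\top)$; and the rules: from $\varphi\Rightarrow\chi$ infer $(\varphi\ast\psi)\Rightarrow(\chi\ast\psi)$; from $(\varphi\ast\psi)\Rightarrow\chi$ infer $\varphi\Rightarrow(\psi\mathrel{-\!\!\ast}\chi)$; from $\varphi\Rightarrow(\psi\mathrel{-\!\!\ast}\chi)$ infer $(\varphi\ast\psi)\Rightarrow\chi$. *)

theory Defs
  imports
    "HOL-Library.Countable"
    "HOL-Library.Infinite_Typeclass"
    "HOL-Library.Finite_Map"
begin

section \<open>Syntax\<close>

datatype 'v form =
    Eq 'v 'v                      (infix "\<^bold>=" 70)
  | PointsTo 'v 'v                (infix "\<hookrightarrow>" 70)
  | Emp
  | Neg "'v form"                 ("\<^bold>\<not> _" [68] 68)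
  | Conj "'v form" "'v form"      (infixr "\<^bold>\<and>" 62)
  | Star "'v form" "'v form"      (infixr "\<^bold>*" 64)
  | Wand "'v form" "'v form"      (infixr "\<^bold>-\<^bold>*" 63)

definition Imp :: "'v form \<Rightarrow> 'v form \<Rightarrow> 'v form" (infixr "\<^bold>\<longrightarrow>" 58) where
  "\<phi> \<^bold>\<longrightarrow> \<psi> = \<^bold>\<not> (\<phi> \<^bold>\<and> \<^bold>\<not> \<psi>)"

definition Iff :: "'v form \<Rightarrow> 'v form \<Rightarrow> 'v form" (infix "\<^bold>\<longleftrightarrow>" 56) where
  "\<phi> \<^bold>\<longleftrightarrow> \<psi> = ((\<phi> \<^bold>\<longrightarrow> \<psi>) \<^bold>\<and> (\<psi> \<^bold>\<longrightarrow> \<phi>))"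

text \<open>The variable in the definition of falsity is immaterial; \<open>undefined\<close> picks an
  arbitrary fixed one.\<close>

definition Bot :: "'v form" where
  "Bot = \<^bold>\<not> (undefined \<^bold>= undefined)"

definition Top :: "'v form" where
  "Top = \<^bold>\<not> Bot"

definition Septraction :: "'v form \<Rightarrow> 'v form \<Rightarrow> 'v form" (infixr "\<^bold>-\<circledast>" 63) where
  "\<phi> \<^bold>-\<circledast> \<psi> = \<^bold>\<not> (\<phi> \<^bold>-\<^bold>* \<^bold>\<not> \<psi>)"

definition alloc :: "'v \<Rightarrow> 'v form" where
  "alloc x = (x \<hookrightarrow> x) \<^bold>-\<^bold>* Bot"

fun size_ge :: "nat \<Rightarrow> 'v form" where
  "size_ge 0 = Top"
| "size_ge (Suc 0) = \<^bold>\<not> Emp"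
| "size_ge (Suc (Suc n)) = (\<^bold>\<not> Emp) \<^bold>* size_ge (Suc n)"

definition size_eq :: "nat \<Rightarrow> 'v form" where
  "size_eq n = size_ge n \<^bold>\<and> \<^bold>\<not> size_ge (n + 1)"

text \<open>Finite conjunction, along an arbitrary fixed enumeration of \<open>X\<close>; the empty conjunction
  is \<open>Top\<close>. Meaningful for finite \<open>X\<close> only.\<close>

definition BigConj :: "'v set \<Rightarrow> ('v \<Rightarrow> 'v form) \<Rightarrow> 'v form" where
  "BigConj X f = foldr (\<lambda>x \<psi>. f x \<^bold>\<and> \<psi>) (SOME xs. distinct xs \<and> set xs = X) Top"

section \<open>Semantics\<close>

type_synonym 'l heap = "('l, 'l) fmap"

definition hdisj :: "'l heap \<Rightarrow> 'l heap \<Rightarrow> bool" where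
  "hdisj h1 h2 \<longleftrightarrow> fmdom h1 |\<inter>| fmdom h2 = {||}"

fun sat :: "('v \<Rightarrow> 'l) \<Rightarrow> 'l heap \<Rightarrow> 'v form \<Rightarrow> bool" where
  "sat s h (x \<^bold>= y) \<longleftrightarrow> s x = s y"
| "sat s h (x \<hookrightarrow> y) \<longleftrightarrow> fmlookup h (s x) = Some (s y)"
| "sat s h Emp \<longleftrightarrow> fmdom h = {||}"
| "sat s h (\<^bold>\<not> \<phi>) \<longleftrightarrow> \<not> sat s h \<phi>"
| "sat s h (\<phi> \<^bold>\<and> \<psi>) \<longleftrightarrow> sat s h \<phi> \<and> sat s h \<psi>"
| "sat s h (\<phi> \<^bold>* \<psi>) \<longleftrightarrow>
     (\<exists>h1 h2. hdisj h1 h2 \<and> h = h1 ++\<^sub>f h2 \<and> sat s h1 \<phi> \<and> sat s h2 \<psi>)"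
| "sat s h (\<phi> \<^bold>-\<^bold>* \<psi>) \<longleftrightarrow>
     (\<forall>h1. hdisj h1 h \<longrightarrow> sat s h1 \<phi> \<longrightarrow> sat s (h ++\<^sub>f h1) \<psi>)"

text \<open>The type argument fixes the set of locations, which does not occur in the type of
  formulae.\<close>

definition valid :: "'l itself \<Rightarrow> 'v form \<Rightarrow> bool" where
  "valid LOC \<phi> \<longleftrightarrow> (\<forall>(s :: 'v \<Rightarrow> 'l) h. sat s h \<phi>)"

section \<open>The proof system\<close>

text \<open>The first six rules axiomatise classical propositional logic (together with
  modus ponens); disjunction is definable and needs no schemata of its own.\<close>

inductive derivable :: "'v form \<Rightarrow> bool" ("\<turnstile> _" [55] 55) where
  prop_K: "\<turnstile> \<phi> \<^bold>\<longrightarrow> (\<psi> \<^bold>\<longrightarrow> \<phi>)"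
| prop_S: "\<turnstile> (\<phi> \<^bold>\<longrightarrow> (\<psi> \<^bold>\<longrightarrow> \<chi>)) \<^bold>\<longrightarrow> ((\<phi> \<^bold>\<longrightarrow> \<psi>) \<^bold>\<longrightarrow> (\<phi> \<^bold>\<longrightarrow> \<chi>))"
| prop_contrapos: "\<turnstile> (\<^bold>\<not> \<phi> \<^bold>\<longrightarrow> \<^bold>\<not> \<psi>) \<^bold>\<longrightarrow> (\<psi> \<^bold>\<longrightarrow> \<phi>)"
| prop_conj1: "\<turnstile> (\<phi> \<^bold>\<and> \<psi>) \<^bold>\<longrightarrow> \<phi>"
| prop_conj2: "\<turnstile> (\<phi> \<^bold>\<and> \<psi>) \<^bold>\<longrightarrow> \<psi>"
| prop_conjI: "\<turnstile> \<phi> \<^bold>\<longrightarrow> (\<psi> \<^bold>\<longrightarrow> (\<phi> \<^bold>\<and> \<psi>))"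
| modus_ponens: "\<turnstile> \<phi> \<Longrightarrow> \<turnstile> \<phi> \<^bold>\<longrightarrow> \<psi> \<Longrightarrow> \<turnstile> \<psi>"
| eq_refl: "\<turnstile> x \<^bold>= x"
| eq_subst: "\<turnstile> (\<phi> \<^bold>\<and> (x \<^bold>= y)) \<^bold>\<longrightarrow> map_form (id(y := x)) \<phi>"
| points_to_alloc: "\<turnstile> (x \<hookrightarrow> y) \<^bold>\<longrightarrow> alloc x"
| points_to_fun: "\<turnstile> ((x \<hookrightarrow> y) \<^bold>\<and> (x \<hookrightarrow> z)) \<^bold>\<longrightarrow> (y \<^bold>= z)"
| star_comm: "\<turnstile> (\<phi> \<^bold>* \<psi>) \<^bold>\<longleftrightarrow> (\<psi> \<^bold>* \<phi>)"
| star_assoc: "\<turnstile> ((\<phi> \<^bold>* \<psi>) \<^bold>* \<chi>) \<^bold>\<longleftrightarrow> (\<phi> \<^bold>* (\<psi> \<^bold>* \<chi>))"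
| star_emp: "\<turnstile> \<phi> \<^bold>\<longleftrightarrow> (\<phi> \<^bold>* Emp)"
| alloc_star_alloc: "\<turnstile> (alloc x \<^bold>* alloc x) \<^bold>\<longleftrightarrow> Bot"
| star_top_mono:
    "\<xi> \<in> {\<^bold>\<not> Emp, x \<^bold>= y, \<^bold>\<not> (x \<^bold>= y), x \<hookrightarrow> y} \<Longrightarrow> \<turnstile> (\<xi> \<^bold>* Top) \<^bold>\<longrightarrow> \<xi>"
| not_alloc_star: "\<turnstile> ((\<^bold>\<not> alloc x) \<^bold>* (\<^bold>\<not> alloc x)) \<^bold>\<longrightarrow> (\<^bold>\<not> alloc x)"
| not_points_to_star: "\<turnstile> ((alloc x \<^bold>\<and> \<^bold>\<not> (x \<hookrightarrow> y)) \<^bold>* Top) \<^bold>\<longrightarrow> (\<^bold>\<not> (x \<hookrightarrow> y))"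
| alloc_split: "\<turnstile> alloc x \<^bold>\<longrightarrow> ((alloc x \<^bold>\<and> size_eq 1) \<^bold>* Top)"
| not_emp_split: "\<turnstile> (\<^bold>\<not> Emp) \<^bold>\<longrightarrow> (size_eq 1 \<^bold>* Top)"
| not_size_ge_star:
    "\<turnstile> ((\<^bold>\<not> size_ge b1) \<^bold>* (\<^bold>\<not> size_ge b2)) \<^bold>\<longrightarrow> (\<^bold>\<not> size_ge (b1 + b2 - 1))"
| alloc_size: "\<turnstile> (alloc x \<^bold>\<and> alloc y \<^bold>\<and> \<^bold>\<not> (x \<^bold>= y)) \<^bold>\<longrightarrow> size_ge 2"
| extend_fresh:
    "finite X \<Longrightarrow> \<turnstile> (size_eq 1 \<^bold>\<and> BigConj X (\<lambda>x. \<^bold>\<not> alloc x)) \<^bold>-\<circledast> Top"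
| extend_points_to:
    "\<turnstile> (\<^bold>\<not> alloc x) \<^bold>\<longrightarrow> (((x \<hookrightarrow> y) \<^bold>\<and> size_eq 1) \<^bold>-\<circledast> Top)"
| extend_alloc:
    "finite X \<Longrightarrow>
     \<turnstile> (\<^bold>\<not> alloc x) \<^bold>\<longrightarrow>
        ((alloc x \<^bold>\<and> size_eq 1 \<^bold>\<and> BigConj X (\<lambda>y. \<^bold>\<not> (x \<hookrightarrow> y))) \<^bold>-\<circledast> Top)"
| star_mono: "\<turnstile> \<phi> \<^bold>\<longrightarrow> \<chi> \<Longrightarrow> \<turnstile> (\<phi> \<^bold>* \<psi>) \<^bold>\<longrightarrow> (\<chi> \<^bold>* \<psi>)"
| wand_intro: "\<turnstile> (\<phi> \<^bold>* \<psi>) \<^bold>\<longrightarrow> \<chi> \<Longrightarrow> \<turnstile> \<phi> \<^bold>\<longrightarrow> (\<psi> \<^bold>-\<^bold>* \<chi>)"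
| wand_elim: "\<turnstile> \<phi> \<^bold>\<longrightarrow> (\<psi> \<^bold>-\<^bold>* \<chi>) \<Longrightarrow> \<turnstile> (\<phi> \<^bold>* \<psi>) \<^bold>\<longrightarrow> \<chi>"

end

theory Submission
  imports Defs "HOL-Library.Extended_Nat"
begin

text \<open>Completeness goes through the canonical model. Its worlds are the maximal consistent sets,
  and \<open>v1\<close>, \<open>v2\<close> compose to \<open>v\<close> if \<open>v\<close> contains every \<open>\<alpha> * \<beta>\<close> with \<open>\<alpha> \<in> v1\<close> and \<open>\<beta> \<in> v2\<close>; the
  structural rules make this composition commutative, associative and unital, and it interprets
  separating conjunction and magic wand. The remaining axioms say that the size of a maximal
  consistent set (an extended natural number) is additive and that cells can be split off and
  added just as in a heap. For a finite set \<open>X\<close> of variables and a bound \<open>b\<close>, a memory state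
  mirrors a maximal consistent set if both agree on the equalities, allocations and points-to facts
  over \<open>X\<close>, and on the number of cells outside the image of \<open>X\<close> up to \<open>b\<close>. Mirroring is a
  bisimulation for composition, where splitting a world uses up part of the bound, so by induction
  on the formula a mirroring state satisfies precisely the members of the set. As every maximal
  consistent set is mirrored by some state, a valid formula belongs to all of them.\<close>

section \<open>Soundness\<close>

text \<open>Two obstacles shape the argument. A maximal consistent set can contain
  \<open>size_ge n\<close> for every \<open>n\<close> and then has no finite heap as an exact
  counterpart. And the possible star factors of a given world are not closed under conjunction, so
  the parts of a composition cannot be found by extending a filter arbitrarily. The first is met by
  the bound on counting: a fixed formula splits a heap only boundedly often. The factors of a star
  share the bound, while both sides of a wand receive it whole, since there cells are only added.
  The second is met by growing a filter inside a prescribed set that is closed under weakening and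
  case distinction (a \<open>grill\<close>); one Zorn argument then serves stars, wands,
  associativity and units. The extension and splitting axioms handle one cell at a time, and heaps
  are finite. A heap extension is therefore copied cell by cell. A heap split is copied by detaching
  the named cells one by one, after which only a number of anonymous cells remains to be
  divided.\<close>

lemma hdisj_iff: "hdisj h1 h2 \<longleftrightarrow> fmdom' h1 \<inter> fmdom' h2 = {}"
  unfolding hdisj_def fmdom'_alt_def by (metis bot_fset.rep_eq fset_inject inf_fset.rep_eq)

lemma hdisj_comm: "hdisj h1 h2 \<longleftrightarrow> hdisj h2 h1"
  by (auto simp: hdisj_iff)

lemma fmdom_empty_iff: "fmdom h = {||} \<longleftrightarrow> fmdom' h = {}"
  unfolding fmdom'_alt_def by (metis bot_fset.rep_eq fset_inject)

lemma fmlookup_hadd: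
  "fmlookup (h1 ++\<^sub>f h2) l = (if l \<in> fmdom' h2 then fmlookup h2 l else fmlookup h1 l)"
  by (simp add: fmdom'_alt_def)

declare fmlookup_add [simp del] fmlookup_hadd [simp]

lemma hadd_comm: "hdisj h1 h2 \<Longrightarrow> h1 ++\<^sub>f h2 = h2 ++\<^sub>f h1"
  by (rule fmap_ext) (auto simp: hdisj_iff fmdom'_notD)

lemma hdisj_hadd: "hdisj h (h1 ++\<^sub>f h2) \<longleftrightarrow> hdisj h h1 \<and> hdisj h h2"
  "hdisj (h1 ++\<^sub>f h2) h \<longleftrightarrow> hdisj h1 h \<and> hdisj h2 h"
  by (auto simp: hdisj_iff)

lemma card_hadd: "hdisj h1 h2 \<Longrightarrow> card (fmdom' h1 \<union> fmdom' h2) = card (fmdom' h1) + card (fmdom' h2)"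
  by (simp add: hdisj_iff card_Un_disjoint)

lemma hsplit: "h = fmrestrict_set A h ++\<^sub>f fmrestrict_set (- A) h"
  "hdisj (fmrestrict_set A h) (fmrestrict_set (- A) h)"
  by (auto simp: hdisj_iff fmdom'_restrict_set_precise intro!: fmap_ext)

lemma sat_star_restrict:
  "sat s (fmrestrict_set A h) \<phi> \<Longrightarrow> sat s (fmrestrict_set (- A) h) \<psi> \<Longrightarrow> sat s h (\<phi> \<^bold>* \<psi>)"
  using hsplit[where h = h and A = A] unfolding sat.simps by blast

section \<open>Meaning of the derived formulae\<close>

lemma sat_Imp [simp]: "sat s h (\<phi> \<^bold>\<longrightarrow> \<psi>) \<longleftrightarrow> (sat s h \<phi> \<longrightarrow> sat s h \<psi>)"
  and sat_Iff [simp]: "sat s h (\<phi> \<^bold>\<longleftrightarrow> \<psi>) \<longleftrightarrow> (sat s h \<phi> \<longleftrightarrow> sat s h \<psi>)"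
  and sat_Bot [simp]: "\<not> sat s h Bot"
  and sat_Top [simp]: "sat s h Top"
  by (auto simp: Imp_def Iff_def Bot_def Top_def)

lemma sat_Septraction [simp]: "sat s h (\<phi> \<^bold>-\<circledast> \<psi>) \<longleftrightarrow>
    (\<exists>h1. hdisj h1 h \<and> sat s h1 \<phi> \<and> sat s (h ++\<^sub>f h1) \<psi>)"
  by (auto simp: Septraction_def)

text \<open>The wand into \<open>Bot\<close> can only hold vacuously, that is, if no heap in which
  \<open>s x\<close> points to itself is disjoint from \<open>h\<close>. If \<open>s x\<close> is
  free, that single cell is such a heap.\<close>

lemma sat_alloc [simp]: "sat s h (alloc x) \<longleftrightarrow> s x \<in> fmdom' h"
proof -
  have "\<exists>h1. hdisj h1 h \<and> fmlookup h1 (s x) = Some (s x)" if "s x \<notin> fmdom' h"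
    using that by (intro exI[of _ "fmupd (s x) (s x) fmempty"]) (simp add: hdisj_iff)
  then show ?thesis by (auto simp: alloc_def hdisj_iff dest: fmdom'I)
qed

lemma sat_size_ge [simp]: "sat s h (size_ge n) \<longleftrightarrow> n \<le> card (fmdom' h)"
proof (induction n arbitrary: h rule: size_ge.induct)
  case 2
  then show ?case by (auto simp: fmdom_empty_iff Suc_le_eq card_gt_0_iff)
next
  case (3 n)
  show ?case
  proof
    assume "sat s h (size_ge (Suc (Suc n)))"
    then obtain h1 h2 where "hdisj h1 h2" "h = h1 ++\<^sub>f h2" "fmdom' h1 \<noteq> {}" "Suc n \<le> card (fmdom' h2)"
      using 3 by (auto simp: fmdom_empty_iff)
    moreover from this have "0 < card (fmdom' h1)" by (simp add: card_gt_0_iff)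
    ultimately show "Suc (Suc n) \<le> card (fmdom' h)" by (simp add: card_hadd)
  next
    assume c: "Suc (Suc n) \<le> card (fmdom' h)"
    then obtain l where l: "l \<in> fmdom' h" by fastforce
    have "fmdom' (fmrestrict_set {l} h) = {l}" using l by (auto simp: fmdom'_restrict_set_precise)
    moreover have "Suc n \<le> card (fmdom' (fmrestrict_set (- {l}) h))"
      using c l by (simp add: fmdom'_restrict_set_precise Diff_eq[symmetric])
    ultimately have "sat s (fmrestrict_set {l} h) (\<^bold>\<not> Emp)" "sat s (fmrestrict_set (- {l}) h) (size_ge (Suc n))"
      using 3 by (simp_all add: fmdom_empty_iff)
    then show "sat s h (size_ge (Suc (Suc n)))"
      unfolding size_ge.simps by (rule sat_star_restrict)
  qed
qed simp

lemma sat_size_eq [simp]: "sat s h (size_eq n) \<longleftrightarrow> card (fmdom' h) = n"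
  by (auto simp: size_eq_def)

lemma BigConj_eq_foldr:
  assumes "finite X"
  obtains xs where "set xs = X" "BigConj X f = foldr (\<lambda>x \<psi>. f x \<^bold>\<and> \<psi>) xs Top"
proof -
  have "\<exists>xs. distinct xs \<and> set xs = X" using finite_distinct_list[OF assms] by blast
  from someI_ex[OF this] show thesis using that unfolding BigConj_def by blast
qed

lemma sat_BigConj [simp]:
  assumes "finite X"
  shows "sat s h (BigConj X f) \<longleftrightarrow> (\<forall>x\<in>X. sat s h (f x))"
proof -
  obtain xs where "set xs = X" "BigConj X f = foldr (\<lambda>x \<psi>. f x \<^bold>\<and> \<psi>) xs Top"
    using BigConj_eq_foldr[OF assms] .
  moreover have "sat s h (foldr (\<lambda>x \<psi>. f x \<^bold>\<and> \<psi>) xs Top) \<longleftrightarrow> (\<forall>x\<in>set xs. sat s h (f x))" for xs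
    by (induction xs) auto
  ultimately show ?thesis by simp
qed

lemma sat_map_form: "sat s h (map_form f \<phi>) \<longleftrightarrow> sat (s \<circ> f) h \<phi>"
  by (induction \<phi> arbitrary: h) auto

lemma sat_star_comm: "sat s h (\<phi> \<^bold>* \<psi>) \<longleftrightarrow> sat s h (\<psi> \<^bold>* \<phi>)"
  using hadd_comm hdisj_comm by (fastforce simp del: fmadd_assoc)

lemma sat_star_assoc: "sat s h ((\<phi> \<^bold>* \<psi>) \<^bold>* \<chi>) \<longleftrightarrow> sat s h (\<phi> \<^bold>* (\<psi> \<^bold>* \<chi>))"
proof
  assume "sat s h ((\<phi> \<^bold>* \<psi>) \<^bold>* \<chi>)"
  then obtain h1 h2 h3 where "hdisj (h1 ++\<^sub>f h2) h3" "hdisj h1 h2" "h = h1 ++\<^sub>f h2 ++\<^sub>f h3"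
    "sat s h1 \<phi>" "sat s h2 \<psi>" "sat s h3 \<chi>" by auto
  moreover from this have "hdisj h1 (h2 ++\<^sub>f h3)" "hdisj h2 h3" "h = h1 ++\<^sub>f (h2 ++\<^sub>f h3)"
    by (auto simp: hdisj_hadd)
  ultimately show "sat s h (\<phi> \<^bold>* (\<psi> \<^bold>* \<chi>))" unfolding sat.simps by blast
next
  assume "sat s h (\<phi> \<^bold>* (\<psi> \<^bold>* \<chi>))"
  then obtain h1 h2 h3 where "hdisj h1 (h2 ++\<^sub>f h3)" "hdisj h2 h3" "h = h1 ++\<^sub>f (h2 ++\<^sub>f h3)"
    "sat s h1 \<phi>" "sat s h2 \<psi>" "sat s h3 \<chi>" unfolding sat.simps by blast
  moreover from this have "hdisj (h1 ++\<^sub>f h2) h3" "hdisj h1 h2" "h = h1 ++\<^sub>f h2 ++\<^sub>f h3"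
    by (auto simp: hdisj_hadd)
  ultimately show "sat s h ((\<phi> \<^bold>* \<psi>) \<^bold>* \<chi>)" unfolding sat.simps by blast
qed

lemma sat_star_Emp:
  fixes s :: "'a \<Rightarrow> 'b"
  shows "sat s h (\<phi> \<^bold>* Emp) \<longleftrightarrow> sat s h \<phi>"
proof -
  have "k = fmempty" if "fmdom' k = {}" for k :: "'b heap"
    using that by (intro fmap_ext) (simp add: fmdom'_notD)
  then have "fmdom h2 = {||} \<longleftrightarrow> h2 = fmempty" for h2 :: "'b heap"
    unfolding fmdom_empty_iff by auto
  then show ?thesis by (auto simp: hdisj_iff)
qed

text \<open>The infinity of the locations supplies the fresh address for \<open>extend_fresh\<close>
  and the fresh cell content for \<open>extend_alloc\<close>.\<close>

theorem soundness:
  fixes s :: "'v \<Rightarrow> 'l::infinite"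
  assumes "\<turnstile> \<phi>"
  shows "sat s h \<phi>"
  using assms
proof (induction arbitrary: h)
  case (eq_subst \<phi> x y)
  \<comment> \<open>Renaming a formula amounts to composing the store with the renaming, which
    changes nothing once \<open>x\<close> and \<open>y\<close> share a location.\<close>
  have "s x = s y \<Longrightarrow> s \<circ> id(y := x) = s" by (auto simp: fun_eq_iff)
  then show ?case by (simp add: sat_map_form)
next
  case (star_comm \<phi> \<psi>)
  show ?case unfolding sat_Iff by (rule sat_star_comm)
next
  case (star_assoc \<phi> \<psi> \<chi>)
  show ?case unfolding sat_Iff by (rule sat_star_assoc)
next
  case (star_emp \<phi>)
  show ?case unfolding sat_Iff by (simp only: sat_star_Emp)
next
  case (star_top_mono \<xi> x y)
  then show ?case by (auto simp: hdisj_iff fmdom_empty_iff; blast dest: fmdom'I)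
next
  case (not_points_to_star x y)
  show ?case by (auto simp: hdisj_iff split: if_splits)
next
  case (alloc_split x)
  have "sat s h ((alloc x \<^bold>\<and> size_eq 1) \<^bold>* Top)" if "s x \<in> fmdom' h"
    by (rule sat_star_restrict[where A = "{s x}"]) (use that in \<open>simp_all add: fmdom'_restrict_set_precise\<close>)
  then show ?case by simp
next
  case not_emp_split
  have "sat s h (size_eq 1 \<^bold>* Top)" if "l \<in> fmdom' h" for l
    by (rule sat_star_restrict[where A = "{l}"]) (use that in \<open>simp_all add: fmdom'_restrict_set_precise\<close>)
  then show ?case by (auto simp: fmdom_empty_iff simp del: sat.simps(6))
next
  case (not_size_ge_star b1 b2)
  show ?case by (auto simp: card_hadd)
next
  case (alloc_size x y)
  have "2 \<le> card (fmdom' h)" if "s x \<in> fmdom' h" "s y \<in> fmdom' h" "s x \<noteq> s y"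
    using card_mono[of "fmdom' h" "{s x, s y}"] that by simp
  then show ?case by simp
next
  case (extend_fresh X)
  obtain l where l: "l \<notin> fmdom' h \<union> s ` X"
    using ex_new_if_finite[of "fmdom' h \<union> s ` X"] extend_fresh infinite_UNIV by auto
  then show ?case using extend_fresh
    by (auto simp: hdisj_iff intro!: exI[of _ "fmupd l l fmempty"])
next
  case (extend_points_to x y)
  show ?case by (auto simp: hdisj_iff intro!: exI[of _ "fmupd (s x) (s y) fmempty"])
next
  case (extend_alloc X x)
  obtain l where "l \<notin> s ` X"
    using ex_new_if_finite[of "s ` X"] extend_alloc infinite_UNIV by auto
  then show ?case using extend_alloc
    by (auto simp: hdisj_iff intro!: exI[of _ "fmupd (s x) l fmempty"])
next
  case (star_mono \<phi> \<chi> \<psi>)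
  then show ?case by auto
next
  case (wand_intro \<phi> \<psi> \<chi>)
  then show ?case using hdisj_comm by (fastforce simp del: fmadd_assoc)
next
  case (wand_elim \<phi> \<psi> \<chi>)
  then show ?case using hdisj_comm by (fastforce simp del: fmadd_assoc)
qed (auto simp: hdisj_iff dest: fmdom'I)

section \<open>Maximal consistent sets\<close>

lemma der_imp_weaken: "\<turnstile> \<psi> \<Longrightarrow> \<turnstile> \<phi> \<^bold>\<longrightarrow> \<psi>"
  by (rule modus_ponens[OF _ prop_K])

lemma der_imp_trans: "\<turnstile> \<phi> \<^bold>\<longrightarrow> \<psi> \<Longrightarrow> \<turnstile> \<psi> \<^bold>\<longrightarrow> \<chi> \<Longrightarrow> \<turnstile> \<phi> \<^bold>\<longrightarrow> \<chi>"
  by (rule modus_ponens[OF _ modus_ponens[OF der_imp_weaken prop_S]])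

lemma der_imp_mp: "\<turnstile> \<phi> \<^bold>\<longrightarrow> (\<psi> \<^bold>\<longrightarrow> \<chi>) \<Longrightarrow> \<turnstile> \<phi> \<^bold>\<longrightarrow> \<psi> \<Longrightarrow> \<turnstile> \<phi> \<^bold>\<longrightarrow> \<chi>"
  by (rule modus_ponens[OF _ modus_ponens[OF _ prop_S]])

lemma der_imp_refl: "\<turnstile> \<phi> \<^bold>\<longrightarrow> \<phi>"
  by (rule der_imp_mp[OF prop_K prop_K])

lemma der_imp_conjI: "\<turnstile> \<phi> \<^bold>\<longrightarrow> \<psi> \<Longrightarrow> \<turnstile> \<phi> \<^bold>\<longrightarrow> \<chi> \<Longrightarrow> \<turnstile> \<phi> \<^bold>\<longrightarrow> (\<psi> \<^bold>\<and> \<chi>)"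
  by (rule der_imp_mp[OF der_imp_trans[OF _ prop_conjI]])

lemma der_conj_mono: "\<turnstile> \<phi> \<^bold>\<longrightarrow> \<psi> \<Longrightarrow> \<turnstile> (\<phi> \<^bold>\<and> \<chi>) \<^bold>\<longrightarrow> (\<psi> \<^bold>\<and> \<chi>)"
  by (rule der_imp_conjI[OF der_imp_trans[OF prop_conj1] prop_conj2])

lemma der_imp_export: "\<turnstile> (\<phi> \<^bold>\<and> \<psi>) \<^bold>\<longrightarrow> \<chi> \<Longrightarrow> \<turnstile> \<phi> \<^bold>\<longrightarrow> (\<psi> \<^bold>\<longrightarrow> \<chi>)"
  by (rule der_imp_trans[OF prop_conjI modus_ponens[OF der_imp_weaken prop_S]])

lemma der_ex_falso: "\<turnstile> (\<phi> \<^bold>\<and> \<^bold>\<not> \<phi>) \<^bold>\<longrightarrow> \<chi>"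
proof -
  have "\<turnstile> \<^bold>\<not> \<phi> \<^bold>\<longrightarrow> (\<phi> \<^bold>\<longrightarrow> \<chi>)"
    by (rule der_imp_trans[OF prop_K prop_contrapos])
  then show ?thesis
    by (rule der_imp_mp[OF der_imp_trans[OF prop_conj2] prop_conj1])
qed

text \<open>Encoded as a two-valued valuation that makes all theorems true. Closure under modus
  ponens comes for free, as implication abbreviates a formula over negation and conjunction.\<close>

definition mcs :: "'v form set \<Rightarrow> bool" where
  "mcs v \<longleftrightarrow> (\<forall>\<phi>. (\<^bold>\<not> \<phi>) \<in> v \<longleftrightarrow> \<phi> \<notin> v) \<and> (\<forall>\<phi> \<psi>. (\<phi> \<^bold>\<and> \<psi>) \<in> v \<longleftrightarrow> \<phi> \<in> v \<and> \<psi> \<in> v) \<and>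
     (\<forall>\<phi>. \<turnstile> \<phi> \<longrightarrow> \<phi> \<in> v)"

text \<open>Dual to a filter: the complement is an ideal of the Lindenbaum algebra. Candidates for a
  new world arise in this form, for instance as the left factors compatible with a given right
  factor.\<close>

definition grill :: "'v form set \<Rightarrow> bool" where
  "grill C \<longleftrightarrow> (\<forall>\<phi> \<psi>. \<turnstile> \<phi> \<^bold>\<longrightarrow> \<psi> \<longrightarrow> \<phi> \<in> C \<longrightarrow> \<psi> \<in> C) \<and>
     (\<forall>\<phi> \<psi>. \<phi> \<in> C \<longrightarrow> (\<phi> \<^bold>\<and> \<psi>) \<in> C \<or> (\<phi> \<^bold>\<and> \<^bold>\<not> \<psi>) \<in> C) \<and> (\<forall>\<phi>. (\<phi> \<^bold>\<and> \<^bold>\<not> \<phi>) \<notin> C)"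

lemma grillI:
  assumes "\<And>\<phi> \<psi>. \<turnstile> \<phi> \<^bold>\<longrightarrow> \<psi> \<Longrightarrow> \<phi> \<in> C \<Longrightarrow> \<psi> \<in> C"
    and "\<And>\<phi> \<psi>. \<phi> \<in> C \<Longrightarrow> (\<phi> \<^bold>\<and> \<psi>) \<notin> C \<Longrightarrow> (\<phi> \<^bold>\<and> \<^bold>\<not> \<psi>) \<notin> C \<Longrightarrow> False"
    and "\<And>\<phi>. (\<phi> \<^bold>\<and> \<^bold>\<not> \<phi>) \<notin> C"
  shows "grill C"
  using assms unfolding grill_def by blast

definition filt :: "'v form set \<Rightarrow> bool" where
  "filt F \<longleftrightarrow> (\<forall>\<phi> \<psi>. \<phi> \<in> F \<longrightarrow> \<turnstile> \<phi> \<^bold>\<longrightarrow> \<psi> \<longrightarrow> \<psi> \<in> F) \<and>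
     (\<forall>\<phi> \<psi>. \<phi> \<in> F \<longrightarrow> \<psi> \<in> F \<longrightarrow> (\<phi> \<^bold>\<and> \<psi>) \<in> F)"

lemma filt_adjoin:
  assumes "filt F"
  shows "filt {\<gamma>. \<exists>f\<in>F. \<turnstile> (f \<^bold>\<and> \<alpha>) \<^bold>\<longrightarrow> \<gamma>}"
  unfolding filt_def
proof (intro conjI allI impI; clarsimp)
  fix \<phi> \<psi> f assume "\<turnstile> \<phi> \<^bold>\<longrightarrow> \<psi>" "f \<in> F" "\<turnstile> (f \<^bold>\<and> \<alpha>) \<^bold>\<longrightarrow> \<phi>"
  then show "\<exists>f\<in>F. \<turnstile> (f \<^bold>\<and> \<alpha>) \<^bold>\<longrightarrow> \<psi>" using der_imp_trans by blast
next
  fix \<phi> \<psi> f g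
  assume "f \<in> F" "\<turnstile> (f \<^bold>\<and> \<alpha>) \<^bold>\<longrightarrow> \<phi>" "g \<in> F" "\<turnstile> (g \<^bold>\<and> \<alpha>) \<^bold>\<longrightarrow> \<psi>"
  moreover from this have "(f \<^bold>\<and> g) \<in> F" using assms by (auto simp: filt_def)
  moreover note der_conj_mono[OF prop_conj1, of f g \<alpha>] der_conj_mono[OF prop_conj2, of f g \<alpha>]
  ultimately show "\<exists>f\<in>F. \<turnstile> (f \<^bold>\<and> \<alpha>) \<^bold>\<longrightarrow> (\<phi> \<^bold>\<and> \<psi>)"
    using der_imp_conjI der_imp_trans by blast
qed

text \<open>A filter that is maximal among those inside \<open>C\<close> decides every formula. If
  it lacked both \<alpha> and its negation, some members \<open>f\<close> and \<open>g\<close> would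
  leave \<open>C\<close> when conjoined with these, although their own conjunction lies in
  \<open>C\<close> and has to survive one of the two cases.\<close>

lemma grill_mcs:
  assumes C: "grill C" and "\<phi> \<in> C"
  obtains v where "mcs v" "\<phi> \<in> v" "v \<subseteq> C"
proof -
  let ?\<F> = "{F. filt F \<and> \<phi> \<in> F \<and> F \<subseteq> C}"
  have up: "\<beta> \<in> C" if "\<turnstile> \<alpha> \<^bold>\<longrightarrow> \<beta>" "\<alpha> \<in> C" for \<alpha> \<beta>
    using C that by (auto simp: grill_def)
  have "\<exists>F\<in>?\<F>. \<forall>G\<in>?\<F>. F \<subseteq> G \<longrightarrow> G = F"
  proof (rule subset_Zorn_nonempty)
    have "{\<alpha>. \<turnstile> \<phi> \<^bold>\<longrightarrow> \<alpha>} \<in> ?\<F>"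
      unfolding filt_def using \<open>\<phi> \<in> C\<close> up der_imp_refl[of \<phi>] der_imp_trans[of \<phi>] der_imp_conjI[of \<phi>]
      by blast
    then show "?\<F> \<noteq> {}" by blast
  next
    fix \<C> assume ne: "\<C> \<noteq> {}" and ch: "subset.chain ?\<F> \<C>"
    then have mem: "filt F \<and> \<phi> \<in> F \<and> F \<subseteq> C" if "F \<in> \<C>" for F
      using that unfolding subset_chain_def by blast
    have "filt (\<Union>\<C>)"
      unfolding filt_def
    proof (intro conjI allI impI)
      fix \<alpha> \<beta> assume "\<alpha> \<in> \<Union>\<C>" "\<turnstile> \<alpha> \<^bold>\<longrightarrow> \<beta>"
      then show "\<beta> \<in> \<Union>\<C>" using mem unfolding filt_def by blast
    next
      fix \<alpha> \<beta> assume "\<alpha> \<in> \<Union>\<C>" "\<beta> \<in> \<Union>\<C>"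
      then obtain F G where "F \<in> \<C>" "G \<in> \<C>" "\<alpha> \<in> F" "\<beta> \<in> G" by blast
      moreover from this have "F \<subseteq> G \<or> G \<subseteq> F"
        using ch unfolding subset_chain_def by blast
      ultimately obtain H where "H \<in> \<C>" "\<alpha> \<in> H" "\<beta> \<in> H" by blast
      then show "(\<alpha> \<^bold>\<and> \<beta>) \<in> \<Union>\<C>" using mem unfolding filt_def by blast
    qed
    then show "\<Union>\<C> \<in> ?\<F>" using mem ne by blast
  qed
  then obtain F where "F \<in> ?\<F>" and max': "\<forall>G\<in>?\<F>. F \<subseteq> G \<longrightarrow> G = F"
    by (rule bexE)
  then have F: "filt F" "\<phi> \<in> F" "F \<subseteq> C" by simp_all
  have max: "G = F" if "filt G" "\<phi> \<in> G" "G \<subseteq> C" "F \<subseteq> G" for G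
    using max' that by simp
  have Fup: "\<beta> \<in> F" if "\<turnstile> \<alpha> \<^bold>\<longrightarrow> \<beta>" "\<alpha> \<in> F" for \<alpha> \<beta>
    using F that by (auto simp: filt_def)
  have Fconj: "(\<alpha> \<^bold>\<and> \<beta>) \<in> F \<longleftrightarrow> \<alpha> \<in> F \<and> \<beta> \<in> F" for \<alpha> \<beta>
    using F(1) Fup[OF prop_conj1, of \<alpha> \<beta>] Fup[OF prop_conj2, of \<alpha> \<beta>] unfolding filt_def by blast
  \<comment> \<open>Otherwise the filter generated by \<open>F\<close> and \<alpha> would still lie
    inside \<open>C\<close>, against maximality.\<close>
  have missing: "\<exists>f\<in>F. (f \<^bold>\<and> \<alpha>) \<notin> C" if "\<alpha> \<notin> F" for \<alpha>
  proof (rule ccontr)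
    assume "\<not> ?thesis"
    then have c: "\<forall>f\<in>F. (f \<^bold>\<and> \<alpha>) \<in> C" by blast
    let ?G = "{\<gamma>. \<exists>f\<in>F. \<turnstile> (f \<^bold>\<and> \<alpha>) \<^bold>\<longrightarrow> \<gamma>}"
    have "F \<subseteq> ?G" using prop_conj1 by blast
    moreover have "?G \<subseteq> C" using c up by blast
    ultimately have "?G = F" using max[OF filt_adjoin[OF F(1)]] F(2) by blast
    moreover have "\<alpha> \<in> ?G" using F(2) prop_conj2 by blast
    ultimately show False using that by simp
  qed
  have Fneg: "(\<^bold>\<not> \<alpha>) \<in> F \<longleftrightarrow> \<alpha> \<notin> F" for \<alpha>
  proof
    assume "(\<^bold>\<not> \<alpha>) \<in> F" then show "\<alpha> \<notin> F"
      using Fconj[of \<alpha> "\<^bold>\<not> \<alpha>"] F(3) C unfolding grill_def by blast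
  next
    assume n: "\<alpha> \<notin> F"
    show "(\<^bold>\<not> \<alpha>) \<in> F"
    proof (rule ccontr)
      assume "(\<^bold>\<not> \<alpha>) \<notin> F"
      then obtain f g where fg: "f \<in> F" "g \<in> F" "(f \<^bold>\<and> \<alpha>) \<notin> C" "(g \<^bold>\<and> \<^bold>\<not> \<alpha>) \<notin> C"
        using missing[OF n] missing by blast
      then have "(f \<^bold>\<and> g) \<in> C" using Fconj F(3) by blast
      then have "((f \<^bold>\<and> g) \<^bold>\<and> \<alpha>) \<in> C \<or> ((f \<^bold>\<and> g) \<^bold>\<and> \<^bold>\<not> \<alpha>) \<in> C"
        using C by (auto simp: grill_def)
      then show False
        using fg up[OF der_conj_mono[OF prop_conj1]] up[OF der_conj_mono[OF prop_conj2]] by blast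
    qed
  qed
  have "mcs F"
    unfolding mcs_def using Fneg Fconj Fup[OF der_imp_weaken F(2)] by blast
  then show thesis using that[of F] F by blast
qed

lemma mcs_neg [simp]: "mcs v \<Longrightarrow> (\<^bold>\<not> \<phi>) \<in> v \<longleftrightarrow> \<phi> \<notin> v"
  and mcs_conj [simp]: "mcs v \<Longrightarrow> (\<phi> \<^bold>\<and> \<psi>) \<in> v \<longleftrightarrow> \<phi> \<in> v \<and> \<psi> \<in> v"
  and mcs_der: "mcs v \<Longrightarrow> \<turnstile> \<phi> \<Longrightarrow> \<phi> \<in> v"
  by (auto simp: mcs_def)

lemma mcs_imp [simp]: "mcs v \<Longrightarrow> (\<phi> \<^bold>\<longrightarrow> \<psi>) \<in> v \<longleftrightarrow> (\<phi> \<in> v \<longrightarrow> \<psi> \<in> v)"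
  and mcs_iff [simp]: "mcs v \<Longrightarrow> (\<phi> \<^bold>\<longleftrightarrow> \<psi>) \<in> v \<longleftrightarrow> (\<phi> \<in> v \<longleftrightarrow> \<psi> \<in> v)"
  by (auto simp: Imp_def Iff_def)

lemma mcs_Bot [simp]: "mcs v \<Longrightarrow> Bot \<notin> v"
  and mcs_Top [simp]: "mcs v \<Longrightarrow> Top \<in> v"
  by (auto simp: Bot_def Top_def intro: mcs_der eq_refl)

lemma derivable_iff_mcs: "\<turnstile> \<phi> \<longleftrightarrow> (\<forall>v. mcs v \<longrightarrow> \<phi> \<in> v)"
proof (intro iffI allI impI; (rule ccontr)?)
  assume all: "\<forall>v. mcs v \<longrightarrow> \<phi> \<in> v" and "\<not> \<turnstile> \<phi>"
  \<comment> \<open>The consistent formulae, in the sense of not implying everything.\<close>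
  let ?C = "{\<alpha>. \<exists>\<gamma>. \<not> \<turnstile> \<alpha> \<^bold>\<longrightarrow> \<gamma>}"
  have "grill ?C"
  proof (rule grillI)
    fix \<alpha> \<beta> assume "\<turnstile> \<alpha> \<^bold>\<longrightarrow> \<beta>" "\<alpha> \<in> ?C"
    then show "\<beta> \<in> ?C" using der_imp_trans by blast
  next
    fix \<alpha> \<beta> assume "\<alpha> \<in> ?C" and n: "(\<alpha> \<^bold>\<and> \<beta>) \<notin> ?C" "(\<alpha> \<^bold>\<and> \<^bold>\<not> \<beta>) \<notin> ?C"
    then obtain \<gamma> where \<gamma>: "\<not> \<turnstile> \<alpha> \<^bold>\<longrightarrow> \<gamma>" by blast
    \<comment> \<open>The second instance is chosen for contraposition: it becomes \<alpha> implying
      \<beta>, which feeds the first.\<close>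
    have "\<turnstile> \<alpha> \<^bold>\<longrightarrow> (\<beta> \<^bold>\<longrightarrow> \<gamma>)" "\<turnstile> \<alpha> \<^bold>\<longrightarrow> (\<^bold>\<not> \<beta> \<^bold>\<longrightarrow> \<^bold>\<not> \<alpha>)"
      using n der_imp_export by blast+
    then have "\<turnstile> \<alpha> \<^bold>\<longrightarrow> \<gamma>"
      by (rule der_imp_mp[OF _ der_imp_mp[OF der_imp_trans[OF _ prop_contrapos] der_imp_refl]])
    then show False using \<gamma> by blast
  qed (use der_ex_falso in blast)
  moreover have "(\<^bold>\<not> \<phi>) \<in> ?C"
  proof (rule ccontr)
    assume "\<not> ?thesis"
    \<comment> \<open>An inconsistent negation of \<phi> refutes even the theorem that \<phi>
      implies itself; contraposition then proves \<phi>.\<close>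
    then have "\<turnstile> \<^bold>\<not> \<phi> \<^bold>\<longrightarrow> \<^bold>\<not> (\<phi> \<^bold>\<longrightarrow> \<phi>)" by blast
    then show False using \<open>\<not> \<turnstile> \<phi>\<close> using modus_ponens[OF der_imp_refl modus_ponens[OF _ prop_contrapos]] by blast
  qed
  ultimately obtain v where "mcs v" "(\<^bold>\<not> \<phi>) \<in> v" by (rule grill_mcs)
  then have "\<phi> \<notin> v" by simp
  then show False using all \<open>mcs v\<close> by blast
qed (simp add: mcs_der)

lemma der_impI: "(\<And>v. mcs v \<Longrightarrow> \<phi> \<in> v \<Longrightarrow> \<psi> \<in> v) \<Longrightarrow> \<turnstile> \<phi> \<^bold>\<longrightarrow> \<psi>"
  by (auto simp: derivable_iff_mcs)

lemma mcs_impD: "mcs v \<Longrightarrow> \<turnstile> \<phi> \<^bold>\<longrightarrow> \<psi> \<Longrightarrow> \<phi> \<in> v \<Longrightarrow> \<psi> \<in> v"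
  using mcs_der mcs_imp by blast

lemma mcs_iffD: "mcs v \<Longrightarrow> \<turnstile> \<phi> \<^bold>\<longleftrightarrow> \<psi> \<Longrightarrow> \<phi> \<in> v \<longleftrightarrow> \<psi> \<in> v"
  using mcs_der mcs_iff by blast

section \<open>The canonical frame\<close>

definition mcomp :: "'v form set \<Rightarrow> 'v form set \<Rightarrow> 'v form set \<Rightarrow> bool" where
  "mcomp v1 v2 v \<longleftrightarrow> mcs v1 \<and> mcs v2 \<and> mcs v \<and> (\<forall>\<alpha> \<beta>. \<alpha> \<in> v1 \<longrightarrow> \<beta> \<in> v2 \<longrightarrow> (\<alpha> \<^bold>* \<beta>) \<in> v)"

lemma mcomp_mcs: "mcomp v1 v2 v \<Longrightarrow> mcs v1" "mcomp v1 v2 v \<Longrightarrow> mcs v2" "mcomp v1 v2 v \<Longrightarrow> mcs v"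
  and mcomp_star: "mcomp v1 v2 v \<Longrightarrow> \<alpha> \<in> v1 \<Longrightarrow> \<beta> \<in> v2 \<Longrightarrow> (\<alpha> \<^bold>* \<beta>) \<in> v"
  by (auto simp: mcomp_def)

lemma mcs_star_comm: "mcs v \<Longrightarrow> (\<phi> \<^bold>* \<psi>) \<in> v \<longleftrightarrow> (\<psi> \<^bold>* \<phi>) \<in> v"
  by (rule mcs_iffD[OF _ star_comm])

lemma star_mono_right: "\<turnstile> \<phi> \<^bold>\<longrightarrow> \<chi> \<Longrightarrow> \<turnstile> (\<psi> \<^bold>* \<phi>) \<^bold>\<longrightarrow> (\<psi> \<^bold>* \<chi>)"
  by (rule der_impI) (simp add: mcs_star_comm[of _ \<psi>] mcs_impD[OF _ star_mono])

lemma mcomp_comm: "mcomp v1 v2 v \<Longrightarrow> mcomp v2 v1 v"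
  unfolding mcomp_def using mcs_star_comm by blast

text \<open>Star distributes over disjunction because it is left adjoint to the wand: both cases
  entail the wand from \<psi> into the disjunction, hence so does \<alpha>.\<close>

lemma mcs_star_cases_left:
  assumes v: "mcs v" and "(\<alpha> \<^bold>* \<psi>) \<in> v"
  shows "((\<alpha> \<^bold>\<and> \<beta>) \<^bold>* \<psi>) \<in> v \<or> ((\<alpha> \<^bold>\<and> \<^bold>\<not> \<beta>) \<^bold>* \<psi>) \<in> v"
proof -
  let ?\<chi> = "\<^bold>\<not> (\<^bold>\<not> ((\<alpha> \<^bold>\<and> \<beta>) \<^bold>* \<psi>) \<^bold>\<and> \<^bold>\<not> ((\<alpha> \<^bold>\<and> \<^bold>\<not> \<beta>) \<^bold>* \<psi>))"
  have "\<turnstile> (\<alpha> \<^bold>\<and> \<beta>) \<^bold>\<longrightarrow> (\<psi> \<^bold>-\<^bold>* ?\<chi>)" "\<turnstile> (\<alpha> \<^bold>\<and> \<^bold>\<not> \<beta>) \<^bold>\<longrightarrow> (\<psi> \<^bold>-\<^bold>* ?\<chi>)"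
    by (rule wand_intro, rule der_impI, simp)+
  then have "\<turnstile> \<alpha> \<^bold>\<longrightarrow> (\<psi> \<^bold>-\<^bold>* ?\<chi>)"
    by (auto simp: derivable_iff_mcs)
  then have "?\<chi> \<in> v" using assms wand_elim mcs_impD by blast
  then show ?thesis using v by simp
qed

lemma mcs_star_false: "mcs v \<Longrightarrow> ((\<alpha> \<^bold>\<and> \<^bold>\<not> \<alpha>) \<^bold>* \<psi>) \<notin> v"
  using mcs_Bot mcs_impD wand_elim[OF der_ex_falso] by blast

lemma mcs_star_weaken_left: "mcs v \<Longrightarrow> (\<alpha> \<^bold>* \<psi>) \<in> v \<Longrightarrow> (\<And>u. mcs u \<Longrightarrow> \<alpha> \<in> u \<Longrightarrow> \<beta> \<in> u) \<Longrightarrow> (\<beta> \<^bold>* \<psi>) \<in> v"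
  by (rule mcs_impD[OF _ star_mono[OF der_impI]])

text \<open>If both cases fail, there are witnesses \<open>a\<close> and \<open>b\<close> in
  \<open>u\<close>; as \<open>u\<close> is closed under conjunction, their conjunction reduces this
  to one case distinction under the star.\<close>

lemma grill_star:
  assumes u: "mcs u" and v: "mcs v"
  shows "grill {\<beta>. \<forall>\<alpha>\<in>u. (\<alpha> \<^bold>* \<beta>) \<in> v}"
proof -
  let ?C = "{\<beta>. \<forall>\<alpha>\<in>u. (\<alpha> \<^bold>* \<beta>) \<in> v}"
  have "\<beta> \<in> ?C" if "\<turnstile> \<alpha> \<^bold>\<longrightarrow> \<beta>" "\<alpha> \<in> ?C" for \<alpha> \<beta>
    using that mcs_impD[OF v star_mono_right] by blast
  moreover have "(\<beta> \<^bold>\<and> \<gamma>) \<in> ?C \<or> (\<beta> \<^bold>\<and> \<^bold>\<not> \<gamma>) \<in> ?C" if C: "\<beta> \<in> ?C" for \<beta> \<gamma>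
  proof (rule ccontr)
    assume "\<not> ?thesis"
    then obtain a b where ab: "a \<in> u" "b \<in> u"
      "(a \<^bold>* (\<beta> \<^bold>\<and> \<gamma>)) \<notin> v" "(b \<^bold>* (\<beta> \<^bold>\<and> \<^bold>\<not> \<gamma>)) \<notin> v" by blast
    then have "((a \<^bold>\<and> b) \<^bold>* \<beta>) \<in> v" using C u by simp
    then have "((a \<^bold>\<and> b) \<^bold>* (\<beta> \<^bold>\<and> \<gamma>)) \<in> v \<or> ((a \<^bold>\<and> b) \<^bold>* (\<beta> \<^bold>\<and> \<^bold>\<not> \<gamma>)) \<in> v"
      using v mcs_star_cases_left by (simp add: mcs_star_comm[of v "a \<^bold>\<and> b"])
    then show False
      using ab v star_mono[OF prop_conj1] star_mono[OF prop_conj2] mcs_impD by blast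
  qed
  moreover have "(\<beta> \<^bold>\<and> \<^bold>\<not> \<beta>) \<notin> ?C" for \<beta>
    using mcs_star_false[OF v] mcs_star_comm[OF v] mcs_Top[OF u] by blast
  ultimately show ?thesis unfolding grill_def by blast
qed

text \<open>The factors are chosen in turn: \<open>v1\<close> only has to be compatible with \<psi>,
  and then \<open>v2\<close> with all of \<open>v1\<close>, which is again a grill
  condition.\<close>

lemma mcs_starE:
  assumes v: "mcs v" and star: "(\<phi> \<^bold>* \<psi>) \<in> v"
  obtains v1 v2 where "mcomp v1 v2 v" "\<phi> \<in> v1" "\<psi> \<in> v2"
proof -
  have "grill {\<alpha>. (\<alpha> \<^bold>* \<psi>) \<in> v}"
    unfolding grill_def mem_Collect_eq
    using mcs_star_cases_left[OF v] mcs_star_false[OF v] mcs_impD[OF v star_mono] by blast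
  moreover have "\<phi> \<in> {\<alpha>. (\<alpha> \<^bold>* \<psi>) \<in> v}" using star by simp
  ultimately obtain v1 where v1: "mcs v1" "\<phi> \<in> v1" "v1 \<subseteq> {\<alpha>. (\<alpha> \<^bold>* \<psi>) \<in> v}"
    by (rule grill_mcs)
  then have "\<psi> \<in> {\<beta>. \<forall>\<alpha>\<in>v1. (\<alpha> \<^bold>* \<beta>) \<in> v}" by blast
  with grill_star[OF v1(1) v] obtain v2
    where "mcs v2" "\<psi> \<in> v2" "v2 \<subseteq> {\<beta>. \<forall>\<alpha>\<in>v1. (\<alpha> \<^bold>* \<beta>) \<in> v}"
    by (rule grill_mcs)
  then show thesis using that[of v1 v2] v v1 by (auto simp: mcomp_def)
qed

lemma der_star_impI:
  "(\<And>v1 v2 v. mcomp v1 v2 v \<Longrightarrow> \<phi> \<in> v1 \<Longrightarrow> \<psi> \<in> v2 \<Longrightarrow> \<chi> \<in> v) \<Longrightarrow> \<turnstile> (\<phi> \<^bold>* \<psi>) \<^bold>\<longrightarrow> \<chi>"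
  by (rule der_impI, erule (1) mcs_starE) blast

section \<open>Magic wand, associativity and units in the canonical frame\<close>

lemma mcomp_wand:
  assumes "mcomp v1 v2 v" "(\<phi> \<^bold>-\<^bold>* \<psi>) \<in> v1" "\<phi> \<in> v2"
  shows "\<psi> \<in> v"
proof -
  have "\<turnstile> ((\<phi> \<^bold>-\<^bold>* \<psi>) \<^bold>* \<phi>) \<^bold>\<longrightarrow> \<psi>" by (rule wand_elim[OF der_imp_refl])
  then show ?thesis using assms mcomp_mcs mcomp_star mcs_impD by metis
qed

text \<open>The introduction rule read in the frame. The rule takes a single formula on the left, so
  one member \<theta> of \<open>v\<close> has to carry all the information used about the left
  factor.\<close>

lemma mcs_wandI:
  assumes "mcs v" "\<theta> \<in> v" "\<And>v1 v2 w. mcomp v1 v2 w \<Longrightarrow> \<theta> \<in> v1 \<Longrightarrow> \<phi> \<in> v2 \<Longrightarrow> \<psi> \<in> w"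
  shows "(\<phi> \<^bold>-\<^bold>* \<psi>) \<in> v"
  by (rule mcs_impD[OF assms(1) wand_intro[OF der_star_impI] assms(2)]) (rule assms(3))

lemma mcs_wand_mono:
  assumes v: "mcs v" and w: "(\<alpha> \<^bold>-\<^bold>* \<beta>) \<in> v"
    and "\<And>u. mcs u \<Longrightarrow> \<alpha>' \<in> u \<Longrightarrow> \<alpha> \<in> u" "\<And>u. mcs u \<Longrightarrow> \<beta> \<in> u \<Longrightarrow> \<beta>' \<in> u"
  shows "(\<alpha>' \<^bold>-\<^bold>* \<beta>') \<in> v"
proof (rule mcs_wandI[OF v w])
  fix v1 v2 u assume c: "mcomp v1 v2 u" "(\<alpha> \<^bold>-\<^bold>* \<beta>) \<in> v1" "\<alpha>' \<in> v2"
  have "\<alpha> \<in> v2" by (rule assms(3)[OF mcomp_mcs(2)[OF c(1)] c(3)])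
  then have "\<beta> \<in> u" by (rule mcomp_wand[OF c(1,2)])
  then show "\<beta>' \<in> u" by (rule assms(4)[OF mcomp_mcs(3)[OF c(1)]])
qed

text \<open>As for star, two grills in turn: first the extension \<open>v1\<close> among the
  formulae whose wand into \<psi> fails, then the result \<open>w\<close> among those that no member
  of \<open>v1\<close> excludes by a wand in \<open>v\<close>.\<close>

lemma mcs_not_wandE:
  assumes v: "mcs v" and nw: "(\<phi> \<^bold>-\<^bold>* \<psi>) \<notin> v"
  obtains v1 w where "mcomp v v1 w" "\<phi> \<in> v1" "\<psi> \<notin> w"
proof -
  \<comment> \<open>Two wands in \<open>v\<close> combine into a third along any implication valid
    in all worlds; this gives the case distinction for both grills.\<close>
  have split: "(\<alpha>'' \<^bold>-\<^bold>* \<beta>'') \<in> v"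
    if "(\<alpha> \<^bold>-\<^bold>* \<beta>) \<in> v" "(\<alpha>' \<^bold>-\<^bold>* \<beta>') \<in> v"
      "\<And>u w. mcs u \<Longrightarrow> mcs w \<Longrightarrow> \<alpha>'' \<in> u \<Longrightarrow> (\<alpha> \<in> u \<longrightarrow> \<beta> \<in> w) \<Longrightarrow> (\<alpha>' \<in> u \<longrightarrow> \<beta>' \<in> w) \<Longrightarrow> \<beta>'' \<in> w"
    for \<alpha> \<beta> \<alpha>' \<beta>' \<alpha>'' \<beta>''
  proof (rule mcs_wandI[OF v])
    show "((\<alpha> \<^bold>-\<^bold>* \<beta>) \<^bold>\<and> (\<alpha>' \<^bold>-\<^bold>* \<beta>')) \<in> v" using that v by simp
  next
    fix v1 v2 w
    assume c: "mcomp v1 v2 w" "((\<alpha> \<^bold>-\<^bold>* \<beta>) \<^bold>\<and> (\<alpha>' \<^bold>-\<^bold>* \<beta>')) \<in> v1" "\<alpha>'' \<in> v2"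
    then have m: "mcs v1" "mcs v2" "mcs w" using mcomp_mcs by blast+
    then show "\<beta>'' \<in> w" using that(3)[OF m(2,3) c(3)] mcomp_wand[OF c(1)] c(2) mcs_conj[OF m(1)] by blast
  qed
  let ?D = "{\<alpha>. (\<alpha> \<^bold>-\<^bold>* \<psi>) \<notin> v}"
  have "grill ?D"
  proof (rule grillI)
    fix \<alpha> \<beta> assume h: "\<turnstile> \<alpha> \<^bold>\<longrightarrow> \<beta>" "\<alpha> \<in> ?D"
    have "(\<alpha> \<^bold>-\<^bold>* \<psi>) \<in> v" if "(\<beta> \<^bold>-\<^bold>* \<psi>) \<in> v"
      by (rule mcs_wand_mono[OF v that]) (use mcs_impD[OF _ h(1)] in auto)
    then show "\<beta> \<in> ?D" using h(2) by blast
  next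
    fix \<alpha> \<beta> assume a: "\<alpha> \<in> ?D" "(\<alpha> \<^bold>\<and> \<beta>) \<notin> ?D" "(\<alpha> \<^bold>\<and> \<^bold>\<not> \<beta>) \<notin> ?D"
    then have w: "((\<alpha> \<^bold>\<and> \<beta>) \<^bold>-\<^bold>* \<psi>) \<in> v" "((\<alpha> \<^bold>\<and> \<^bold>\<not> \<beta>) \<^bold>-\<^bold>* \<psi>) \<in> v" by simp_all
    have "(\<alpha> \<^bold>-\<^bold>* \<psi>) \<in> v" by (rule split[OF w]) auto
    then show False using a by simp
  next
    fix \<alpha>
    have "((\<alpha> \<^bold>\<and> \<^bold>\<not> \<alpha>) \<^bold>-\<^bold>* \<psi>) \<in> v"
      by (rule mcs_wandI[OF v mcs_Top[OF v]]) (simp add: mcomp_mcs(2,3))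
    then show "(\<alpha> \<^bold>\<and> \<^bold>\<not> \<alpha>) \<notin> ?D" by simp
  qed
  moreover have "\<phi> \<in> ?D" using nw by simp
  ultimately obtain v1 where v1: "mcs v1" "\<phi> \<in> v1" "v1 \<subseteq> ?D" by (rule grill_mcs)
  let ?C = "{\<beta>. \<forall>\<alpha>\<in>v1. (\<alpha> \<^bold>-\<^bold>* \<^bold>\<not> \<beta>) \<notin> v}"
  have "grill ?C"
  proof (rule grillI)
    fix \<beta> \<beta>' assume h: "\<turnstile> \<beta> \<^bold>\<longrightarrow> \<beta>'" "\<beta> \<in> ?C"
    have "(\<alpha> \<^bold>-\<^bold>* \<^bold>\<not> \<beta>) \<in> v" if "(\<alpha> \<^bold>-\<^bold>* \<^bold>\<not> \<beta>') \<in> v" for \<alpha>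
      by (rule mcs_wand_mono[OF v that]) (use mcs_impD[OF _ h(1)] in auto)
    then show "\<beta>' \<in> ?C" using h(2) by blast
  next
    fix \<beta> \<gamma> assume C: "\<beta> \<in> ?C" "(\<beta> \<^bold>\<and> \<gamma>) \<notin> ?C" "(\<beta> \<^bold>\<and> \<^bold>\<not> \<gamma>) \<notin> ?C"
    then obtain a b where ab: "a \<in> v1" "b \<in> v1"
      "(a \<^bold>-\<^bold>* \<^bold>\<not> (\<beta> \<^bold>\<and> \<gamma>)) \<in> v" "(b \<^bold>-\<^bold>* \<^bold>\<not> (\<beta> \<^bold>\<and> \<^bold>\<not> \<gamma>)) \<in> v" by blast
    have "((a \<^bold>\<and> b) \<^bold>-\<^bold>* \<^bold>\<not> \<beta>) \<in> v"
      by (rule split[OF ab(3,4)]) auto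
    then show False using ab C(1) v1(1) by simp
  next
    fix \<beta>
    have "(\<phi> \<^bold>-\<^bold>* \<^bold>\<not> (\<beta> \<^bold>\<and> \<^bold>\<not> \<beta>)) \<in> v"
      by (rule mcs_wandI[OF v mcs_Top[OF v]]) (simp add: mcomp_mcs(2,3))
    then show "(\<beta> \<^bold>\<and> \<^bold>\<not> \<beta>) \<notin> ?C" using v1 by blast
  qed
  moreover have "(\<^bold>\<not> \<psi>) \<in> ?C"
  proof -
    have "(\<alpha> \<^bold>-\<^bold>* \<psi>) \<in> v" if "(\<alpha> \<^bold>-\<^bold>* \<^bold>\<not> \<^bold>\<not> \<psi>) \<in> v" for \<alpha>
      by (rule mcs_wand_mono[OF v that]) auto
    then show ?thesis using v1(3) by blast
  qed
  ultimately obtain w where w: "mcs w" "(\<^bold>\<not> \<psi>) \<in> w" "w \<subseteq> ?C"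
    by (rule grill_mcs)
  \<comment> \<open>Every \<gamma> in \<open>v\<close> yields the wand from \<alpha> into the star
    of the two, so \<open>w\<close> cannot contain the negation of that star.\<close>
  have "(\<gamma> \<^bold>* \<alpha>) \<in> w" if "\<gamma> \<in> v" "\<alpha> \<in> v1" for \<gamma> \<alpha>
  proof (rule ccontr)
    assume "(\<gamma> \<^bold>* \<alpha>) \<notin> w"
    then have "(\<^bold>\<not> (\<gamma> \<^bold>* \<alpha>)) \<in> w" using w(1) by simp
    then have "(\<^bold>\<not> (\<gamma> \<^bold>* \<alpha>)) \<in> ?C" using w(3) by blast
    then have "(\<alpha> \<^bold>-\<^bold>* \<^bold>\<not> \<^bold>\<not> (\<gamma> \<^bold>* \<alpha>)) \<notin> v" using that by blast
    moreover have "(\<alpha> \<^bold>-\<^bold>* \<^bold>\<not> \<^bold>\<not> (\<gamma> \<^bold>* \<alpha>)) \<in> v"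
    proof (rule mcs_wandI[OF v that(1)])
      fix v1 v2 u assume "mcomp v1 v2 u" "\<gamma> \<in> v1" "\<alpha> \<in> v2"
      then show "(\<^bold>\<not> \<^bold>\<not> (\<gamma> \<^bold>* \<alpha>)) \<in> u" using mcs_neg[OF mcomp_mcs(3)] mcomp_star by blast
    qed
    ultimately show False by simp
  qed
  then show thesis using that[of v1 w] v v1 w by (auto simp: mcomp_def)
qed

lemma mcs_septractionE:
  assumes "mcs v" "(\<phi> \<^bold>-\<circledast> \<psi>) \<in> v"
  obtains v1 w where "mcomp v v1 w" "\<phi> \<in> v1" "\<psi> \<in> w"
proof -
  have "(\<phi> \<^bold>-\<^bold>* \<^bold>\<not> \<psi>) \<notin> v" using assms by (simp add: Septraction_def)
  from mcs_not_wandE[OF assms(1) this] obtain v1 w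
    where "mcomp v v1 w" "\<phi> \<in> v1" "(\<^bold>\<not> \<psi>) \<notin> w" .
  then show thesis using that mcs_neg[OF mcomp_mcs(3)] by blast
qed

text \<open>The intermediate world \<open>f\<close> must contain all products of \<open>b\<close>
  and \<open>d\<close> and also compose with \<open>a\<close> to \<open>e\<close>. The grill
  \<open>?C\<close> imposes both at once by keeping such a product conjoined with \<phi> under the
  star.\<close>

lemma mcomp_assoc:
  assumes ab: "mcomp a b c" and cd: "mcomp c d e"
  obtains f where "mcomp b d f" "mcomp a f e"
proof -
  have m: "mcs a" "mcs b" "mcs c" "mcs d" "mcs e" using assms mcomp_mcs by blast+
  let ?C = "{\<phi>. \<forall>\<alpha> \<beta> \<delta>. \<alpha> \<in> a \<longrightarrow> \<beta> \<in> b \<longrightarrow> \<delta> \<in> d \<longrightarrow> (\<alpha> \<^bold>* (\<phi> \<^bold>\<and> (\<beta> \<^bold>* \<delta>))) \<in> e}"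
  have assoc: "(\<alpha> \<^bold>* (\<beta> \<^bold>* \<delta>)) \<in> e" if "\<alpha> \<in> a" "\<beta> \<in> b" "\<delta> \<in> d" for \<alpha> \<beta> \<delta>
    using mcomp_star[OF cd mcomp_star[OF ab]] that mcs_iffD[OF m(5) star_assoc] by blast
  have weaken: "(\<alpha>' \<^bold>* \<beta>') \<in> e"
    if "(\<alpha> \<^bold>* \<beta>) \<in> e" "\<And>u. mcs u \<Longrightarrow> \<alpha> \<in> u \<Longrightarrow> \<alpha>' \<in> u" "\<And>u. mcs u \<Longrightarrow> \<beta> \<in> u \<Longrightarrow> \<beta>' \<in> u" for \<alpha> \<alpha>' \<beta> \<beta>'
  proof -
    have "(\<alpha>' \<^bold>* \<beta>) \<in> e" by (rule mcs_star_weaken_left[OF m(5) that(1,2)])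
    then have "(\<beta> \<^bold>* \<alpha>') \<in> e" by (simp add: mcs_star_comm[OF m(5)])
    then have "(\<beta>' \<^bold>* \<alpha>') \<in> e" by (rule mcs_star_weaken_left[OF m(5) _ that(3)])
    then show ?thesis by (simp add: mcs_star_comm[OF m(5)])
  qed
  have false: "(\<alpha> \<^bold>* \<beta>) \<notin> e" if "\<And>u. mcs u \<Longrightarrow> \<beta> \<notin> u" for \<alpha> \<beta>
    by (rule notI, erule mcs_starE[OF m(5)]) (blast dest: that mcomp_mcs(2))
  have st: "(y \<^bold>* z) \<in> u"
    if u: "mcs u" "(y' \<^bold>* z') \<in> u"
      and le: "\<And>u. mcs u \<Longrightarrow> y' \<in> u \<Longrightarrow> y \<in> u" "\<And>u. mcs u \<Longrightarrow> z' \<in> u \<Longrightarrow> z \<in> u"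
    for u y z y' z'
  proof -
    obtain u1 u2 where u12: "mcomp u1 u2 u" "y' \<in> u1" "z' \<in> u2" using mcs_starE[OF u] .
    then have "y \<in> u1" "z \<in> u2" using le mcomp_mcs by blast+
    with u12(1) show ?thesis by (rule mcomp_star)
  qed
  have "grill ?C"
  proof (rule grillI)
    fix \<phi> \<psi> assume h: "\<turnstile> \<phi> \<^bold>\<longrightarrow> \<psi>" "\<phi> \<in> ?C"
    have "(\<alpha> \<^bold>* (\<psi> \<^bold>\<and> (\<beta> \<^bold>* \<delta>))) \<in> e" if "(\<alpha> \<^bold>* (\<phi> \<^bold>\<and> (\<beta> \<^bold>* \<delta>))) \<in> e" for \<alpha> \<beta> \<delta>
      by (rule weaken[OF that]) (use mcs_impD[OF _ h(1)] in auto)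
    then show "\<psi> \<in> ?C" using h(2) by blast
  next
    fix \<phi> \<psi> assume C: "\<phi> \<in> ?C" "(\<phi> \<^bold>\<and> \<psi>) \<notin> ?C" "(\<phi> \<^bold>\<and> \<^bold>\<not> \<psi>) \<notin> ?C"
    obtain x y z where xyz: "x \<in> a" "y \<in> b" "z \<in> d" "(x \<^bold>* ((\<phi> \<^bold>\<and> \<psi>) \<^bold>\<and> (y \<^bold>* z))) \<notin> e"
      using C(2) by blast
    obtain x' y' z' where xyz': "x' \<in> a" "y' \<in> b" "z' \<in> d"
      "(x' \<^bold>* ((\<phi> \<^bold>\<and> \<^bold>\<not> \<psi>) \<^bold>\<and> (y' \<^bold>* z'))) \<notin> e"
      using C(3) by blast
    let ?\<theta> = "\<phi> \<^bold>\<and> ((y \<^bold>\<and> y') \<^bold>* (z \<^bold>\<and> z'))"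
    have "((x \<^bold>\<and> x') \<^bold>* ?\<theta>) \<in> e" using C(1) m xyz xyz' by simp
    then have "((x \<^bold>\<and> x') \<^bold>* (?\<theta> \<^bold>\<and> \<psi>)) \<in> e \<or> ((x \<^bold>\<and> x') \<^bold>* (?\<theta> \<^bold>\<and> \<^bold>\<not> \<psi>)) \<in> e"
      using mcs_star_cases_left[OF m(5)] by (simp add: mcs_star_comm[OF m(5), of "x \<^bold>\<and> x'"])
    then show False
    proof
      assume "((x \<^bold>\<and> x') \<^bold>* (?\<theta> \<^bold>\<and> \<psi>)) \<in> e"
      then have "(x \<^bold>* ((\<phi> \<^bold>\<and> \<psi>) \<^bold>\<and> (y \<^bold>* z))) \<in> e"
        by (rule weaken) (auto elim: st)
      then show False using xyz by blast
    next
      assume "((x \<^bold>\<and> x') \<^bold>* (?\<theta> \<^bold>\<and> \<^bold>\<not> \<psi>)) \<in> e"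
      then have "(x' \<^bold>* ((\<phi> \<^bold>\<and> \<^bold>\<not> \<psi>) \<^bold>\<and> (y' \<^bold>* z'))) \<in> e"
        by (rule weaken) (auto elim: st)
      then show False using xyz' by blast
    qed
  next
    fix \<phi>
    have "(Top \<^bold>* ((\<phi> \<^bold>\<and> \<^bold>\<not> \<phi>) \<^bold>\<and> (Top \<^bold>* Top))) \<notin> e" by (rule false) simp
    then show "(\<phi> \<^bold>\<and> \<^bold>\<not> \<phi>) \<notin> ?C" using m mcs_Top by blast
  qed
  moreover have "Top \<in> ?C"
  proof -
    have "(\<alpha> \<^bold>* (Top \<^bold>\<and> (\<beta> \<^bold>* \<delta>))) \<in> e" if "\<alpha> \<in> a" "\<beta> \<in> b" "\<delta> \<in> d" for \<alpha> \<beta> \<delta>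
      by (rule weaken[OF assoc[OF that]]) auto
    then show ?thesis by blast
  qed
  ultimately obtain f where f: "mcs f" "f \<subseteq> ?C"
    by (rule grill_mcs)
  \<comment> \<open>With the negated product in \<open>f\<close>, the definition of
    \<open>?C\<close> would put a contradiction under a star in \<open>e\<close>.\<close>
  have "(\<beta> \<^bold>* \<delta>) \<in> f" if "\<beta> \<in> b" "\<delta> \<in> d" for \<beta> \<delta>
  proof (rule ccontr)
    assume "(\<beta> \<^bold>* \<delta>) \<notin> f"
    then have "(\<^bold>\<not> (\<beta> \<^bold>* \<delta>)) \<in> f" using f(1) by simp
    then have "(\<^bold>\<not> (\<beta> \<^bold>* \<delta>)) \<in> ?C" using f(2) by blast
    then have "(Top \<^bold>* (\<^bold>\<not> (\<beta> \<^bold>* \<delta>) \<^bold>\<and> (\<beta> \<^bold>* \<delta>))) \<in> e" using that m by simp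
    moreover have "(Top \<^bold>* (\<^bold>\<not> (\<beta> \<^bold>* \<delta>) \<^bold>\<and> (\<beta> \<^bold>* \<delta>))) \<notin> e" by (rule false) simp
    ultimately show False by blast
  qed
  then have "mcomp b d f" using m f by (auto simp: mcomp_def)
  moreover have "mcomp a f e"
  proof -
    have "(\<alpha> \<^bold>* \<phi>) \<in> e" if "\<alpha> \<in> a" "\<phi> \<in> f" for \<alpha> \<phi>
    proof -
      have "(\<alpha> \<^bold>* (\<phi> \<^bold>\<and> (Top \<^bold>* Top))) \<in> e" using that f(2) m mcs_Top by blast
      then show ?thesis by (rule weaken) auto
    qed
    then show ?thesis using m f by (auto simp: mcomp_def)
  qed
  ultimately show thesis using that by blast
qed

text \<open>There is no single unit, since a world with \<open>Emp\<close> still fixes all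
  equalities; each \<open>v\<close> has its own, found in the grill of right factors that keep
  \<open>v\<close> in place.\<close>

lemma mcomp_unit:
  assumes v: "mcs v"
  obtains e where "mcomp v e v" "Emp \<in> e"
proof -
  have "Emp \<in> {\<beta>. \<forall>\<alpha>\<in>v. (\<alpha> \<^bold>* \<beta>) \<in> v}" using mcs_iffD[OF v star_emp] by blast
  with grill_star[OF v v] obtain e
    where "mcs e" "Emp \<in> e" "e \<subseteq> {\<beta>. \<forall>\<alpha>\<in>v. (\<alpha> \<^bold>* \<beta>) \<in> v}"
    by (rule grill_mcs)
  then show thesis using that[of e] v by (auto simp: mcomp_def)
qed

section \<open>Core formulae in the canonical frame\<close>

lemma mcs_BigConj:
  assumes v: "mcs v" and "finite X"
  shows "BigConj X f \<in> v \<longleftrightarrow> (\<forall>x\<in>X. f x \<in> v)"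
proof -
  obtain xs where "set xs = X" "BigConj X f = foldr (\<lambda>x \<psi>. f x \<^bold>\<and> \<psi>) xs Top"
    using BigConj_eq_foldr[OF assms(2)] .
  moreover have "foldr (\<lambda>x \<psi>. f x \<^bold>\<and> \<psi>) xs Top \<in> v \<longleftrightarrow> (\<forall>x\<in>set xs. f x \<in> v)" for xs
    by (induction xs) (use v in auto)
  ultimately show ?thesis by simp
qed

text \<open>The axiom gives one direction; its instance for the negated formula gives the
  other.\<close>

lemma mcs_subst:
  assumes v: "mcs v" and e: "(x \<^bold>= y) \<in> v"
  shows "\<phi> \<in> v \<longleftrightarrow> map_form (id(y := x)) \<phi> \<in> v"
proof -
  have "map_form (id(y := x)) \<psi> \<in> v" if "\<psi> \<in> v" for \<psi>
    using mcs_impD[OF v eq_subst[of \<psi> x y]] that e v by simp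
  from this[of \<phi>] this[of "\<^bold>\<not> \<phi>"] show ?thesis using v by auto
qed

lemma mcs_eq_refl: "mcs v \<Longrightarrow> (x \<^bold>= x) \<in> v"
  by (simp add: mcs_der eq_refl)

lemma mcs_eq_sym:
  assumes "mcs v" "(x \<^bold>= y) \<in> v"
  shows "(y \<^bold>= x) \<in> v"
  using mcs_subst[OF assms, of "y \<^bold>= x"] mcs_eq_refl[OF assms(1)] by simp

lemma mcs_eq_trans:
  assumes v: "mcs v" and xy: "(x \<^bold>= y) \<in> v" and yz: "(y \<^bold>= z) \<in> v"
  shows "(x \<^bold>= z) \<in> v"
  \<comment> \<open>If \<open>z\<close> is \<open>y\<close>, the substitution rewrites both sides,
    but then the claim is just \<open>xy\<close>.\<close>
  using mcs_subst[OF v xy, of "y \<^bold>= z"] xy yz by (cases "z = y") auto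

lemma mcs_alloc_cong:
  assumes v: "mcs v" and xy: "(x \<^bold>= y) \<in> v"
  shows "alloc x \<in> v \<longleftrightarrow> alloc y \<in> v"
proof -
  \<comment> \<open>The substitution may also rename the fixed variable inside \<open>Bot\<close>,
    so the image of \<open>alloc y\<close> need not literally be \<open>alloc x\<close>; the renamed
    falsity belongs to no world either, which is enough under the wand.\<close>
  let ?B = "map_form (id(y := x)) Bot"
  have "?B \<notin> u" if "mcs u" for u
    using that by (simp add: Bot_def mcs_eq_refl)
  then have "((x \<hookrightarrow> x) \<^bold>-\<^bold>* Bot) \<in> v \<longleftrightarrow> ((x \<hookrightarrow> x) \<^bold>-\<^bold>* ?B) \<in> v"
    using mcs_wand_mono[OF v] mcs_Bot by meson
  then show ?thesis using mcs_subst[OF v xy, of "alloc y"] by (simp add: alloc_def)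
qed

lemma mcs_points_to_cong:
  assumes v: "mcs v" and xx: "(x \<^bold>= x') \<in> v" and yy: "(y \<^bold>= y') \<in> v"
  shows "(x \<hookrightarrow> y) \<in> v \<longleftrightarrow> (x' \<hookrightarrow> y') \<in> v"
proof -
  have "(x \<hookrightarrow> y) \<in> v \<longleftrightarrow> (x' \<hookrightarrow> y) \<in> v"
    using mcs_subst[OF v xx, of "x \<hookrightarrow> y"] mcs_subst[OF v xx, of "x' \<hookrightarrow> y"] by auto
  also have "\<dots> \<longleftrightarrow> (x' \<hookrightarrow> y') \<in> v"
    using mcs_subst[OF v yy, of "x' \<hookrightarrow> y"] mcs_subst[OF v yy, of "x' \<hookrightarrow> y'"] by auto
  finally show ?thesis .
qed

lemma mcs_points_to_alloc: "mcs v \<Longrightarrow> (x \<hookrightarrow> y) \<in> v \<Longrightarrow> alloc x \<in> v"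
  by (rule mcs_impD[OF _ points_to_alloc])

lemma mcs_points_to_fun: "mcs v \<Longrightarrow> (x \<hookrightarrow> y) \<in> v \<Longrightarrow> (x \<hookrightarrow> z) \<in> v \<Longrightarrow> (y \<^bold>= z) \<in> v"
  by (rule mcs_impD[OF _ points_to_fun]) simp_all

lemma mcomp_Top_left: "mcomp v1 v2 v \<Longrightarrow> \<phi> \<in> v1 \<Longrightarrow> (\<phi> \<^bold>* Top) \<in> v"
  by (rule mcomp_star[OF _ _ mcs_Top[OF mcomp_mcs(2)]])

lemma mcomp_mono:
  assumes "mcomp v1 v2 v" "\<xi> \<in> v1" "\<xi> \<in> {\<^bold>\<not> Emp, x \<^bold>= y, \<^bold>\<not> (x \<^bold>= y), x \<hookrightarrow> y}"
  shows "\<xi> \<in> v"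
  by (rule mcs_impD[OF mcomp_mcs(3)[OF assms(1)] star_top_mono[OF assms(3)] mcomp_Top_left[OF assms(1,2)]])

lemma mcomp_eq: "mcomp v1 v2 v \<Longrightarrow> (x \<^bold>= y) \<in> v1 \<longleftrightarrow> (x \<^bold>= y) \<in> v"
  using mcomp_mono[of v1 v2 v "x \<^bold>= y" x y] mcomp_mono[of v1 v2 v "\<^bold>\<not> (x \<^bold>= y)" x y]
    mcs_neg[OF mcomp_mcs(1), of v1 v2 v "x \<^bold>= y"] mcs_neg[OF mcomp_mcs(3), of v1 v2 v "x \<^bold>= y"]
  by auto

lemma mcomp_eq_right: "mcomp v1 v2 v \<Longrightarrow> (x \<^bold>= y) \<in> v2 \<longleftrightarrow> (x \<^bold>= y) \<in> v"
  by (rule mcomp_eq[OF mcomp_comm])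

text \<open>Persistence of \<open>alloc\<close> is not among the axioms and comes from its
  definition. A failure in \<open>v\<close> gives an extension \<open>a\<close> in which
  \<open>x\<close> points to itself; regrouped, \<open>v2\<close> with \<open>a\<close> extends
  \<open>v1\<close> and meets its wand into \<open>Bot\<close>.\<close>

lemma mcomp_alloc_left:
  assumes c: "mcomp v1 v2 v" and "alloc x \<in> v1"
  shows "alloc x \<in> v"
proof (rule ccontr)
  assume "alloc x \<notin> v"
  then obtain a w where aw: "mcomp v a w" "(x \<hookrightarrow> x) \<in> a"
    unfolding alloc_def by (rule mcs_not_wandE[OF mcomp_mcs(3)[OF c]])
  obtain f where f: "mcomp v2 a f" "mcomp v1 f w" using mcomp_assoc[OF c aw(1)] .
  have "(x \<hookrightarrow> x) \<in> f" by (rule mcomp_mono[OF mcomp_comm[OF f(1)] aw(2)]) simp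
  then have "Bot \<in> w" using mcomp_wand[OF f(2)] assms(2) unfolding alloc_def by blast
  then show False using mcs_Bot mcomp_mcs(3)[OF f(2)] by blast
qed

lemma mcomp_alloc:
  assumes c: "mcomp v1 v2 v"
  shows "alloc x \<in> v \<longleftrightarrow> alloc x \<in> v1 \<or> alloc x \<in> v2"
proof
  assume a: "alloc x \<in> v"
  show "alloc x \<in> v1 \<or> alloc x \<in> v2"
  proof (rule ccontr)
    assume "\<not> ?thesis"
    then have "((\<^bold>\<not> alloc x) \<^bold>* (\<^bold>\<not> alloc x)) \<in> v"
      by (intro mcomp_star[OF c]) (simp_all add: mcomp_mcs[OF c])
    then have "(\<^bold>\<not> alloc x) \<in> v" by (rule mcs_impD[OF mcomp_mcs(3)[OF c] not_alloc_star])
    then show False using a mcs_neg[OF mcomp_mcs(3)[OF c]] by blast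
  qed
qed (use mcomp_alloc_left[OF c] mcomp_alloc_left[OF mcomp_comm[OF c]] in blast)

lemma mcomp_alloc_disjoint:
  assumes c: "mcomp v1 v2 v" and "alloc x \<in> v1"
  shows "alloc x \<notin> v2"
proof
  assume "alloc x \<in> v2"
  then have "(alloc x \<^bold>* alloc x) \<in> v" using mcomp_star[OF c assms(2)] by blast
  then show False
    using mcs_iffD[OF mcomp_mcs(3)[OF c] alloc_star_alloc] mcs_Bot[OF mcomp_mcs(3)[OF c]] by blast
qed

text \<open>By \<open>not_points_to_star\<close>, the factor that allocates \<open>x\<close> also
  settles what \<open>x\<close> does not point to.\<close>

lemma mcomp_points_to_left:
  assumes c: "mcomp v1 v2 v" and "alloc x \<in> v1"
  shows "(x \<hookrightarrow> y) \<in> v \<longleftrightarrow> (x \<hookrightarrow> y) \<in> v1"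
proof
  assume p: "(x \<hookrightarrow> y) \<in> v"
  show "(x \<hookrightarrow> y) \<in> v1"
  proof (rule ccontr)
    assume "(x \<hookrightarrow> y) \<notin> v1"
    then have "((alloc x \<^bold>\<and> \<^bold>\<not> (x \<hookrightarrow> y)) \<^bold>* Top) \<in> v"
      using assms by (intro mcomp_Top_left[OF c]) (simp add: mcomp_mcs[OF c])
    then have "(\<^bold>\<not> (x \<hookrightarrow> y)) \<in> v" by (rule mcs_impD[OF mcomp_mcs(3)[OF c] not_points_to_star])
    then show False using p mcs_neg[OF mcomp_mcs(3)[OF c]] by blast
  qed
qed (rule mcomp_mono[OF c], auto)

lemma mcomp_points_to:
  assumes c: "mcomp v1 v2 v"
  shows "(x \<hookrightarrow> y) \<in> v \<longleftrightarrow> (x \<hookrightarrow> y) \<in> v1 \<or> (x \<hookrightarrow> y) \<in> v2"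
  using mcomp_points_to_left[OF c, of x y] mcomp_points_to_left[OF mcomp_comm[OF c], of x y]
    mcomp_alloc[OF c, of x] mcs_points_to_alloc[OF mcomp_mcs(1)[OF c], of x y]
    mcs_points_to_alloc[OF mcomp_mcs(2)[OF c], of x y] mcs_points_to_alloc[OF mcomp_mcs(3)[OF c], of x y]
  by blast

section \<open>The size of a world\<close>

lemma size_ge_mono:
  assumes c: "mcomp v1 v2 v" and "size_ge n \<in> v2"
  shows "size_ge n \<in> v"
  using assms
proof (induction n arbitrary: v1 v2 v rule: size_ge.induct)
  case 1 then show ?case using mcs_Top[OF mcomp_mcs(3)] by simp
next
  case 2
  then show ?case using mcomp_mono[OF mcomp_comm[OF "2.prems"(1)], of "\<^bold>\<not> Emp"] by simp
next
  case (3 n)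
  from "3.prems"(2) obtain a b where ab: "mcomp a b v2" "(\<^bold>\<not> Emp) \<in> a" "size_ge (Suc n) \<in> b"
    unfolding size_ge.simps by (rule mcs_starE[OF mcomp_mcs(2)[OF "3.prems"(1)]])
  obtain f where f: "mcomp b v1 f" "mcomp a f v" using mcomp_assoc[OF ab(1) mcomp_comm[OF "3.prems"(1)]] .
  have "size_ge (Suc n) \<in> f" by (rule "3.IH"[OF mcomp_comm[OF f(1)] ab(3)])
  then show ?case unfolding size_ge.simps by (rule mcomp_star[OF f(2) ab(2)])
qed

lemma size_ge_Suc_star:
  assumes c: "mcomp v1 v2 v" "(\<^bold>\<not> Emp) \<in> v1" "size_ge n \<in> v2"
  shows "size_ge (Suc n) \<in> v"
  using assms mcomp_star[OF c(1,2)] mcomp_mono[OF c(1,2)] by (cases n) auto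

lemma size_ge_SucE:
  assumes v: "mcs v" and "size_ge (Suc n) \<in> v"
  obtains v1 v2 where "mcomp v1 v2 v" "(\<^bold>\<not> Emp) \<in> v1" "size_ge n \<in> v2"
proof (cases n)
  case 0
  \<comment> \<open>\<open>size_ge 1\<close> is plain non-emptiness and not a star, so the second
    factor has to be supplied by a unit.\<close>
  obtain e where "mcomp v e v" "Emp \<in> e" using mcomp_unit[OF v] .
  then show thesis using that[of v e] 0 assms mcs_Top mcomp_mcs(2) by fastforce
next
  case (Suc m)
  then show thesis using that assms(2) mcs_starE[OF v, of "\<^bold>\<not> Emp" "size_ge n"] by auto
qed

lemma size_ge_le:
  assumes v: "mcs v" and "size_ge n \<in> v" and "m \<le> n"
  shows "size_ge m \<in> v"
  using \<open>m \<le> n\<close> assms(2)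
proof (induction rule: inc_induct)
  case (step k)
  from size_ge_SucE[OF v step.IH[OF step.prems]] obtain v1 v2
    where "mcomp v1 v2 v" "size_ge k \<in> v2" by blast
  then show ?case by (rule size_ge_mono)
qed

lemma size_ge_add:
  assumes "mcomp v1 v2 v" "size_ge m \<in> v1" "size_ge n \<in> v2"
  shows "size_ge (m + n) \<in> v"
  using assms
proof (induction m arbitrary: v1 v2 v)
  case 0 then show ?case using size_ge_mono by simp
next
  case (Suc m)
  obtain a b where ab: "mcomp a b v1" "(\<^bold>\<not> Emp) \<in> a" "size_ge m \<in> b"
    using size_ge_SucE[OF mcomp_mcs(1)[OF Suc.prems(1)] Suc.prems(2)] .
  obtain f where f: "mcomp b v2 f" "mcomp a f v" using mcomp_assoc[OF ab(1) Suc.prems(1)] .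
  have "size_ge (m + n) \<in> f" by (rule Suc.IH[OF f(1) ab(3) Suc.prems(3)])
  then show ?case using size_ge_Suc_star[OF f(2) ab(2)] by simp
qed

lemma size_ge_split:
  assumes c: "mcomp v1 v2 v"
  shows "size_ge n \<in> v \<longleftrightarrow> (\<exists>i j. n = i + j \<and> size_ge i \<in> v1 \<and> size_ge j \<in> v2)"
proof
  assume n: "size_ge n \<in> v"
  note m = mcomp_mcs[OF c]
  \<comment> \<open>\<open>i\<close> will be the largest part of \<open>n\<close> that
    \<open>v1\<close> accounts for; the cutoff at \<open>n\<close> ensures that the maximum
    exists.\<close>
  let ?P = "\<lambda>i. i \<le> n \<and> size_ge i \<in> v1"
  define i where "i = (GREATEST i. ?P i)"
  have "?P 0" using m by simp
  then have i: "?P i" unfolding i_def by (rule GreatestI_nat[where b = n]) simp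
  have max: "k \<le> i" if "?P k" for k
    unfolding i_def using that by (rule Greatest_le_nat[where b = n]) simp
  show "\<exists>i j. n = i + j \<and> size_ge i \<in> v1 \<and> size_ge j \<in> v2"
  proof (cases "i = n")
    case True
    then show ?thesis using i m by (intro exI[of _ n] exI[of _ 0]) simp
  next
    case False
    then have "size_ge (Suc i) \<notin> v1" using i max[of "Suc i"] by auto
    \<comment> \<open>\<open>v1\<close> lacks \<open>size_ge (Suc i)\<close>. If \<open>v2\<close>
      lacked \<open>size_ge (n - i)\<close>, then by the axiom \<open>v\<close> would lack the sum
      minus one, which is exactly \<open>n\<close>.\<close>
    have "size_ge (n - i) \<in> v2"
    proof (rule ccontr)
      assume "size_ge (n - i) \<notin> v2"
      then have "((\<^bold>\<not> size_ge (Suc i)) \<^bold>* (\<^bold>\<not> size_ge (n - i))) \<in> v"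
        using \<open>size_ge (Suc i) \<notin> v1\<close> by (intro mcomp_star[OF c]) (simp_all add: m)
      then have "(\<^bold>\<not> size_ge (Suc i + (n - i) - 1)) \<in> v" by (rule mcs_impD[OF m(3) not_size_ge_star])
      moreover have "Suc i + (n - i) - 1 = n" using i by simp
      ultimately show False using n m by simp
    qed
    then show ?thesis using i by (intro exI[of _ i] exI[of _ "n - i"]) simp
  qed
qed (use size_ge_add[OF c] in blast)

definition msize :: "'v form set \<Rightarrow> enat" where
  "msize v = (SUP n\<in>{n. size_ge n \<in> v}. enat n)"

lemma enat_le_msize:
  assumes v: "mcs v"
  shows "enat n \<le> msize v \<longleftrightarrow> size_ge n \<in> v"
proof
  assume le: "enat n \<le> msize v"
  show "size_ge n \<in> v"
  proof (rule ccontr)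
    assume n: "size_ge n \<notin> v"
    then have "n \<noteq> 0" using v by (metis mcs_Top size_ge.simps(1))
    have "m \<le> n - 1" if "size_ge m \<in> v" for m
      using size_ge_le[OF v that, of n] n \<open>n \<noteq> 0\<close> by linarith
    then have "msize v \<le> enat (n - 1)" unfolding msize_def by (intro SUP_least) auto
    with le have "enat n \<le> enat (n - 1)" by (rule order_trans)
    then show False using \<open>n \<noteq> 0\<close> by simp
  qed
qed (auto simp: msize_def intro: SUP_upper)

lemma enat_eqI:
  assumes "\<And>n. enat n \<le> a \<longleftrightarrow> enat n \<le> b"
  shows "a = b"
proof (rule antisym)
  have "a \<le> b" if "\<And>n. enat n \<le> a \<Longrightarrow> enat n \<le> b" for a b
  proof (cases a)
    case (enat n) then show ?thesis using that by simp
  next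
    case infinity
    then have "enat n \<le> b" for n using that by simp
    then have "enat (Suc n) \<le> b" for n by blast
    then have "b = \<infinity>" by (cases b) (auto simp: not_less_eq_eq[symmetric])
    then show ?thesis by simp
  qed
  then show "a \<le> b" "b \<le> a" using assms by blast+
qed

lemma msize_add:
  assumes c: "mcomp v1 v2 v"
  shows "msize v = msize v1 + msize v2"
proof (rule enat_eqI)
  fix n
  have "enat n \<le> a + b \<longleftrightarrow> (\<exists>i j. n = i + j \<and> enat i \<le> a \<and> enat j \<le> b)" for a b :: enat
  proof
    assume le: "enat n \<le> a + b"
    show "\<exists>i j. n = i + j \<and> enat i \<le> a \<and> enat j \<le> b"
    proof (cases "enat n \<le> a")
      case True then show ?thesis by (intro exI[of _ n] exI[of _ 0]) (simp add: zero_enat_def[symmetric])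
    next
      case False
      then obtain k where k: "a = enat k" "k < n" by (cases a) auto
      then have "enat (n - k) \<le> b" using le by (cases b) auto
      then show ?thesis using k by (intro exI[of _ k] exI[of _ "n - k"]) auto
    qed
  next
    assume "\<exists>i j. n = i + j \<and> enat i \<le> a \<and> enat j \<le> b"
    then show "enat n \<le> a + b" by (auto simp flip: plus_enat_simps(1) intro: add_mono)
  qed
  then show "enat n \<le> msize v \<longleftrightarrow> enat n \<le> msize v1 + msize v2"
    by (simp add: enat_le_msize mcomp_mcs[OF c] size_ge_split[OF c])
qed

lemma msize_eq_0: "mcs v \<Longrightarrow> msize v = 0 \<longleftrightarrow> Emp \<in> v"
  using enat_le_msize[of v 1] by (cases "msize v") (auto simp: zero_enat_def)

lemma mcs_size_eq:
  assumes v: "mcs v"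
  shows "size_eq n \<in> v \<longleftrightarrow> msize v = enat n"
proof -
  have "size_eq n \<in> v \<longleftrightarrow> enat n \<le> msize v \<and> \<not> enat (Suc n) \<le> msize v"
    using v by (simp add: size_eq_def enat_le_msize)
  also have "\<dots> \<longleftrightarrow> msize v = enat n" by (cases "msize v") auto
  finally show ?thesis .
qed

lemma mcs_alloc_size:
  assumes v: "mcs v" and "alloc x \<in> v" "alloc y \<in> v" "(x \<^bold>= y) \<notin> v"
  shows "2 \<le> msize v"
proof -
  have "size_ge 2 \<in> v"
    by (rule mcs_impD[OF v alloc_size]) (use assms in simp)
  then have "enat 2 \<le> msize v" using enat_le_msize[OF v] by blast
  then show ?thesis by (simp add: numeral_eq_enat)
qed

section \<open>Detaching and adding cells\<close>

lemma mcs_split_alloc: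
  assumes v: "mcs v" and "alloc x \<in> v"
  obtains c w where "mcomp c w v" "alloc x \<in> c" "msize c = 1"
proof -
  have "((alloc x \<^bold>\<and> size_eq 1) \<^bold>* Top) \<in> v" by (rule mcs_impD[OF v alloc_split assms(2)])
  then obtain c w where c: "mcomp c w v" "(alloc x \<^bold>\<and> size_eq 1) \<in> c"
    by (rule mcs_starE[OF v])
  show thesis
    by (rule that[OF c(1)]) (use c mcomp_mcs(1)[OF c(1)] in \<open>simp_all add: mcs_size_eq one_enat_def\<close>)
qed

text \<open>Factors of size 1 are detached repeatedly and regrouped into one. The rest may be
  infinite, so only the detached amount is prescribed.\<close>

lemma mcs_split_size:
  assumes v: "mcs v" and "enat n \<le> msize v"
  obtains c w where "mcomp c w v" "msize c = enat n"
  using assms(2)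
proof (induction n arbitrary: thesis)
  case 0
  obtain e where "mcomp v e v" "Emp \<in> e" using mcomp_unit[OF v] .
  then have "mcomp e v v" "msize e = enat 0"
    using mcomp_comm msize_eq_0 mcomp_mcs(1) zero_enat_def by metis+
  then show ?case by (rule 0)
next
  case (Suc n)
  have "enat n \<le> msize v" using Suc.prems(2) by (metis Suc_ile_eq order.strict_implies_order)
  with Suc.IH obtain c w where c: "mcomp c w v" "msize c = enat n" by blast
  have w: "mcs w" by (rule mcomp_mcs(2)[OF c(1)])
  have "msize w \<noteq> 0" using Suc.prems(2) msize_add[OF c(1)] c(2) by auto
  then have "(\<^bold>\<not> Emp) \<in> w" using w by (simp add: msize_eq_0)
  then have "(size_eq 1 \<^bold>* Top) \<in> w" by (rule mcs_impD[OF w not_emp_split])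
  then obtain a b where ab: "mcomp a b w" "size_eq 1 \<in> a" by (rule mcs_starE[OF w])
  obtain f where f: "mcomp a c f" "mcomp b f v"
    using mcomp_assoc[OF mcomp_comm[OF ab(1)] mcomp_comm[OF c(1)]] .
  have "msize f = enat (Suc n)"
    using msize_add[OF f(1)] c(2) ab(2) mcs_size_eq[OF mcomp_mcs(1)[OF ab(1)]] by simp
  then show ?case using Suc.prems(1)[OF mcomp_comm[OF f(2)]] by blast
qed

lemma mcs_extend_fresh:
  assumes v: "mcs v" and "finite X"
  obtains c w where "mcomp v c w" "msize c = 1" "\<And>x. x \<in> X \<Longrightarrow> alloc x \<notin> c"
proof -
  have "((size_eq 1 \<^bold>\<and> BigConj X (\<lambda>x. \<^bold>\<not> alloc x)) \<^bold>-\<circledast> Top) \<in> v"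
    by (rule mcs_der[OF v extend_fresh[OF assms(2)]])
  then obtain c w where c: "mcomp v c w" "(size_eq 1 \<^bold>\<and> BigConj X (\<lambda>x. \<^bold>\<not> alloc x)) \<in> c"
    by (rule mcs_septractionE[OF v])
  show thesis
    by (rule that[OF c(1)])
      (use c mcomp_mcs(2)[OF c(1)] \<open>finite X\<close> in \<open>auto simp: mcs_size_eq one_enat_def mcs_BigConj\<close>)
qed

lemma mcs_extend_points_to:
  assumes v: "mcs v" and "alloc x \<notin> v"
  obtains c w where "mcomp v c w" "msize c = 1" "(x \<hookrightarrow> y) \<in> c"
proof -
  have "(((x \<hookrightarrow> y) \<^bold>\<and> size_eq 1) \<^bold>-\<circledast> Top) \<in> v"
    by (rule mcs_impD[OF v extend_points_to]) (use assms in simp)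
  then obtain c w where c: "mcomp v c w" "((x \<hookrightarrow> y) \<^bold>\<and> size_eq 1) \<in> c"
    by (rule mcs_septractionE[OF v])
  show thesis
    by (rule that[OF c(1)]) (use c mcomp_mcs(2)[OF c(1)] in \<open>auto simp: mcs_size_eq one_enat_def\<close>)
qed

lemma mcs_extend_alloc:
  assumes v: "mcs v" and "alloc x \<notin> v" and "finite X"
  obtains c w where "mcomp v c w" "msize c = 1" "alloc x \<in> c" "\<And>y. y \<in> X \<Longrightarrow> (x \<hookrightarrow> y) \<notin> c"
proof -
  let ?\<phi> = "alloc x \<^bold>\<and> size_eq 1 \<^bold>\<and> BigConj X (\<lambda>y. \<^bold>\<not> (x \<hookrightarrow> y))"
  have "(?\<phi> \<^bold>-\<circledast> Top) \<in> v"
    by (rule mcs_impD[OF v extend_alloc[OF assms(3)]]) (use assms in simp)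
  then obtain c w where c: "mcomp v c w" "?\<phi> \<in> c"
    by (rule mcs_septractionE[OF v])
  show thesis
    by (rule that[OF c(1)])
      (use c mcomp_mcs(2)[OF c(1)] \<open>finite X\<close> in \<open>auto simp: mcs_size_eq one_enat_def mcs_BigConj\<close>)
qed

section \<open>Memory states mirroring a maximal consistent set\<close>

text \<open>Equality truncated at \<open>b\<close>. The first count belongs to a world and may be
  infinite, the second to a heap.\<close>

definition approx :: "nat \<Rightarrow> enat \<Rightarrow> nat \<Rightarrow> bool" where
  "approx b u n \<longleftrightarrow> u = enat n \<or> enat b \<le> u \<and> b \<le> n"

lemma approx_mono: "approx b u n \<Longrightarrow> b' \<le> b \<Longrightarrow> approx b' u n"
  unfolding approx_def by (meson enat_ord_simps(1) order_trans)

lemma approx_add: "approx b u1 n1 \<Longrightarrow> approx b u2 n2 \<Longrightarrow> approx b (u1 + u2) (n1 + n2)"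
  unfolding approx_def by (cases u1; cases u2) auto

text \<open>A summand below its own bound must be matched exactly; the other then reaches its bound
  and absorbs the surplus. The bounds add up because both summands may have to reach theirs.\<close>

lemma approx_split:
  assumes "approx (b1 + b2) (u1 + u2) n"
  obtains n1 n2 where "n = n1 + n2" "approx b1 u1 n1" "approx b2 u2 n2"
proof (cases "u1 + u2 = enat n")
  case True
  then obtain n1 n2 where "u1 = enat n1" "u2 = enat n2" by (cases u1; cases u2) auto
  then show thesis using that[of n1 n2] True by (auto simp: approx_def)
next
  case False
  then have h: "enat (b1 + b2) \<le> u1 + u2" "b1 + b2 \<le> n" using assms by (auto simp: approx_def)
  consider "enat b1 \<le> u1" "enat b2 \<le> u2" | "u1 < enat b1" | "u2 < enat b2" by fastforce
  then show thesis
  proof cases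
    case 1
    then have "approx b1 u1 b1" "approx b2 u2 (n - b1)" using h(2) by (auto simp: approx_def)
    then show thesis using that[of b1 "n - b1"] h(2) by simp
  next
    case 2
    then obtain n1 where n1: "u1 = enat n1" "n1 < b1" by (cases u1) auto
    then have "enat b2 \<le> u2" using h by (cases u2) auto
    then have "approx b1 u1 n1" "approx b2 u2 (n - n1)" using h(2) n1 by (auto simp: approx_def)
    then show thesis using that[of n1 "n - n1"] h(2) n1 by simp
  next
    case 3
    then obtain n2 where n2: "u2 = enat n2" "n2 < b2" by (cases u2) auto
    then have "enat b1 \<le> u1" using h by (cases u1) auto
    then have "approx b1 u1 (n - n2)" "approx b2 u2 n2" using h(2) n2 by (auto simp: approx_def)
    then show thesis using that[of "n - n2" n2] h(2) n2 by simp
  qed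
qed

text \<open>The opposite problem: the heap count comes already split and the world count
  \<open>u\<close> has to follow. A world can be made to detach a prescribed finite amount
  \<open>m\<close>, and the remainder \<open>r\<close> is whatever is left; the two outcomes differ
  in which side receives \<open>m\<close>.\<close>

lemma approx_split_right:
  assumes "approx (b1 + b2) u (n1 + n2)"
  obtains m where "enat m \<le> u" "\<And>r. u = enat m + r \<Longrightarrow> approx b1 (enat m) n1 \<and> approx b2 r n2"
  | m where "enat m \<le> u" "\<And>r. u = enat m + r \<Longrightarrow> approx b1 r n1 \<and> approx b2 (enat m) n2"
proof (cases "u = enat (n1 + n2)")
  case True
  have "approx b1 (enat n1) n1 \<and> approx b2 r n2" if "u = enat n1 + r" for r
    using that True by (cases r) (auto simp: approx_def)
  then show thesis using that(1)[of n1] True by simp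
next
  case False
  then have h: "enat (b1 + b2) \<le> u" "b1 + b2 \<le> n1 + n2" using assms by (auto simp: approx_def)
  consider "n1 < b1" | "n2 < b2" | "b1 \<le> n1" "b2 \<le> n2" by linarith
  then show thesis
  proof cases
    case 1
    have "approx b1 (enat n1) n1 \<and> approx b2 r n2" if "u = enat n1 + r" for r
      using that h 1 by (cases r) (auto simp: approx_def)
    moreover have "enat n1 \<le> u" using h 1 by (cases u) auto
    ultimately show thesis using that(1) by blast
  next
    case 2
    have "approx b1 r n1 \<and> approx b2 (enat n2) n2" if "u = enat n2 + r" for r
      using that h 2 by (cases r) (auto simp: approx_def)
    moreover have "enat n2 \<le> u" using h 2 by (cases u) auto
    ultimately show thesis using that(2) by blast
  next
    case 3
    have "approx b1 (enat b1) n1 \<and> approx b2 r n2" if "u = enat b1 + r" for r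
      using that h 3 by (cases r) (auto simp: approx_def)
    moreover have "enat b1 \<le> u" using h by (cases u) auto
    ultimately show thesis using that(1) by blast
  qed
qed

definition agrees :: "'v set \<Rightarrow> 'v form set \<Rightarrow> ('v \<Rightarrow> 'l) \<Rightarrow> bool" where
  "agrees X v s \<longleftrightarrow> mcs v \<and> (\<forall>x\<in>X. \<forall>y\<in>X. (x \<^bold>= y) \<in> v \<longleftrightarrow> s x = s y)"

text \<open>Locations rather than variables, so that equal variables count as one cell.\<close>

definition named :: "'v set \<Rightarrow> 'v form set \<Rightarrow> ('v \<Rightarrow> 'l) \<Rightarrow> 'l set" where
  "named X v s = s ` {x \<in> X. alloc x \<in> v}"

text \<open>The witness \<open>u\<close>, the surplus of \<open>v\<close> over its named cells,
  avoids a subtraction of extended naturals. The content of a named cell is recorded only by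
  comparison with the variables in \<open>X\<close>; of the other cells nothing but their
  approximate number is recorded.\<close>

definition mirrors :: "'v set \<Rightarrow> nat \<Rightarrow> 'v form set \<Rightarrow> ('v \<Rightarrow> 'l) \<Rightarrow> 'l heap \<Rightarrow> bool" where
  "mirrors X b v s h \<longleftrightarrow> agrees X v s \<and> named X v s = s ` X \<inter> fmdom' h \<and>
     (\<forall>x\<in>X. \<forall>y\<in>X. (x \<hookrightarrow> y) \<in> v \<longleftrightarrow> fmlookup h (s x) = Some (s y)) \<and>
     (\<exists>u. msize v = enat (card (named X v s)) + u \<and> approx b u (card (fmdom' h - s ` X)))"

lemma mirrors_mono: "mirrors X b v s h \<Longrightarrow> b' \<le> b \<Longrightarrow> mirrors X b' v s h"
  unfolding mirrors_def using approx_mono by blast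

lemma agrees_mcs: "agrees X v s \<Longrightarrow> mcs v"
  and mirrors_agrees: "mirrors X b v s h \<Longrightarrow> agrees X v s"
  by (auto simp: agrees_def mirrors_def)

lemma agrees_left: "mcomp v1 v2 v \<Longrightarrow> agrees X v1 s \<longleftrightarrow> agrees X v s"
  and agrees_right: "mcomp v1 v2 v \<Longrightarrow> agrees X v2 s \<longleftrightarrow> agrees X v s"
  unfolding agrees_def by (simp_all add: mcomp_mcs mcomp_eq mcomp_eq_right)

lemma in_named: "agrees X v s \<Longrightarrow> x \<in> X \<Longrightarrow> s x \<in> named X v s \<longleftrightarrow> alloc x \<in> v"
  unfolding named_def agrees_def by (auto simp: image_iff dest: mcs_alloc_cong)

lemma named_subset: "named X v s \<subseteq> s ` X"
  by (auto simp: named_def)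

lemma finite_named: "finite X \<Longrightarrow> finite (named X v s)"
  by (simp add: named_def)

lemma named_mcomp: "mcomp v1 v2 v \<Longrightarrow> named X v s = named X v1 s \<union> named X v2 s"
  by (auto simp: named_def mcomp_alloc)

lemma named_disjoint:
  assumes c: "mcomp v1 v2 v" and ag: "agrees X v s"
  shows "named X v1 s \<inter> named X v2 s = {}"
proof -
  have a: "agrees X v1 s" "agrees X v2 s" using agrees_left[OF c] agrees_right[OF c] ag by blast+
  have False if "x \<in> X" "s x \<in> named X v1 s" "s x \<in> named X v2 s" for x
    using that in_named[OF a(1), of x] in_named[OF a(2), of x] mcomp_alloc_disjoint[OF c, of x] by blast
  then show ?thesis using named_subset[of X v1 s] by blast
qed

lemma points_to_imp_named: "mcs v \<Longrightarrow> x \<in> X \<Longrightarrow> (x \<hookrightarrow> y) \<in> v \<Longrightarrow> s x \<in> named X v s"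
  by (auto simp: named_def mcs_points_to_alloc)

text \<open>By \<open>alloc_size\<close>, two unequal allocated variables would force size at least
  2.\<close>

lemma named_single:
  assumes ag: "agrees X c s" and "x \<in> X" "alloc x \<in> c" "msize c = 1"
  shows "named X c s = {s x}"
proof -
  note m = agrees_mcs[OF ag]
  have "(x \<^bold>= y) \<in> c" if "alloc y \<in> c" for y
    using mcs_alloc_size[OF m assms(3) that] assms(4) by (auto simp: one_enat_def numeral_eq_enat)
  moreover have "(x \<^bold>= y) \<in> c \<longleftrightarrow> s x = s y" if "y \<in> X" for y
    using that ag assms(2) unfolding agrees_def by blast
  ultimately have "s y = s x" if "alloc y \<in> c" "y \<in> X" for y
    using that by metis
  moreover have "x \<in> {x \<in> X. alloc x \<in> c}" using assms(2,3) by simp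
  ultimately show ?thesis unfolding named_def by blast
qed

text \<open>Splitting off one named cell at a time, distinct named cells contribute separately to the size.\<close>

lemma card_named_le:
  assumes "finite X" "agrees X v s"
  shows "enat (card (named X v s)) \<le> msize v"
  using assms(2)
proof (induction "card (named X v s)" arbitrary: v)
  case 0
  then show ?case by (simp add: zero_enat_def[symmetric])
next
  case (Suc n)
  then have "named X v s \<noteq> {}" by auto
  then obtain x where x: "x \<in> X" "alloc x \<in> v" by (auto simp: named_def)
  obtain c w where c: "mcomp c w v" "alloc x \<in> c" "msize c = 1"
    using mcs_split_alloc[OF agrees_mcs[OF Suc.prems] x(2)] .
  have ag: "agrees X c s" "agrees X w s"
    using agrees_left[OF c(1)] agrees_right[OF c(1)] Suc.prems by blast+
  have "card (named X v s) = card (named X c s) + card (named X w s)"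
    unfolding named_mcomp[OF c(1)]
    by (rule card_Un_disjoint) (simp_all add: finite_named assms(1) named_disjoint[OF c(1) Suc.prems])
  then have w: "card (named X v s) = Suc (card (named X w s))"
    using named_single[OF ag(1) x(1) c(2,3)] by simp
  then have "enat (card (named X w s)) \<le> msize w" using Suc.hyps ag(2) by simp
  then show ?case
    using w msize_add[OF c(1)] c(3) by (cases "msize w") (auto simp: one_enat_def)
qed

text \<open>The bound is kept, because two equalities truncated at \<open>b\<close> add up to one
  truncated at \<open>b\<close>. This is why a wand adds nothing to the required bound.\<close>

lemma mirrors_add:
  assumes X: "finite X" and c: "mcomp v1 v2 v" and d: "hdisj h1 h2"
    and m1: "mirrors X b v1 s h1" and m2: "mirrors X b v2 s h2"
  shows "mirrors X b v s (h1 ++\<^sub>f h2)"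
proof -
  have ag: "agrees X v s" using agrees_left[OF c] mirrors_agrees[OF m1] by blast
  obtain u1 u2 where u: "msize v1 = enat (card (named X v1 s)) + u1" "approx b u1 (card (fmdom' h1 - s ` X))"
    "msize v2 = enat (card (named X v2 s)) + u2" "approx b u2 (card (fmdom' h2 - s ` X))"
    using m1 m2 unfolding mirrors_def by blast
  have "card (named X v s) = card (named X v1 s) + card (named X v2 s)"
    unfolding named_mcomp[OF c]
    by (rule card_Un_disjoint) (simp_all add: finite_named X named_disjoint[OF c ag])
  then have "msize v = enat (card (named X v s)) + (u1 + u2)"
    using msize_add[OF c] u by (simp add: ac_simps flip: plus_enat_simps(1))
  moreover have "card (fmdom' (h1 ++\<^sub>f h2) - s ` X) = card (fmdom' h1 - s ` X) + card (fmdom' h2 - s ` X)"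
    using d card_Un_disjoint[of "fmdom' h1 - s ` X" "fmdom' h2 - s ` X"]
    by (auto simp: hdisj_iff Un_Diff)
  moreover have "named X v s = s ` X \<inter> fmdom' (h1 ++\<^sub>f h2)"
    using m1 m2 named_mcomp[OF c, of X s] unfolding mirrors_def by auto
  moreover have "(x \<hookrightarrow> y) \<in> v \<longleftrightarrow> fmlookup (h1 ++\<^sub>f h2) (s x) = Some (s y)" if "x \<in> X" "y \<in> X" for x y
  proof -
    have "(x \<hookrightarrow> y) \<in> v \<longleftrightarrow> fmlookup h1 (s x) = Some (s y) \<or> fmlookup h2 (s x) = Some (s y)"
      using m1 m2 that unfolding mirrors_def mcomp_points_to[OF c] by blast
    then show ?thesis using d by (auto simp: hdisj_iff dest: fmdom'I)
  qed
  ultimately show ?thesis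
    using ag approx_add[OF u(2,4)] unfolding mirrors_def by auto
qed

text \<open>The share of a factor in the heap consists of its named cells, which are forced, and a
  set \<open>U\<close> of other cells, of which only the cardinality matters.\<close>

lemma mirrors_restrict:
  assumes m: "mirrors X b v s h" and c: "mcomp v1 v2 v"
    and u: "msize v1 = enat (card (named X v1 s)) + u" "approx b1 u (card U)"
    and U: "U \<subseteq> fmdom' h - s ` X"
  shows "mirrors X b1 v1 s (fmrestrict_set (named X v1 s \<union> U) h)"
proof -
  have ag: "agrees X v1 s" using agrees_left[OF c] mirrors_agrees[OF m] by blast
  have sub: "named X v1 s \<subseteq> s ` X \<inter> fmdom' h"
    using m named_mcomp[OF c, of X s] unfolding mirrors_def by blast
  have "(x \<hookrightarrow> y) \<in> v1 \<longleftrightarrow> fmlookup (fmrestrict_set (named X v1 s \<union> U) h) (s x) = Some (s y)"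
    if xy: "x \<in> X" "y \<in> X" for x y
  proof (cases "alloc x \<in> v1")
    case True
    then have "(x \<hookrightarrow> y) \<in> v1 \<longleftrightarrow> fmlookup h (s x) = Some (s y)"
      using mcomp_points_to_left[OF c] m xy unfolding mirrors_def by blast
    then show ?thesis using True in_named[OF ag xy(1)] by simp
  next
    case False
    then show ?thesis using in_named[OF ag xy(1)] U xy mcs_points_to_alloc[OF mcomp_mcs(1)[OF c]] by auto
  qed
  moreover have "fmdom' (fmrestrict_set (named X v1 s \<union> U) h) - s ` X = U"
    "s ` X \<inter> fmdom' (fmrestrict_set (named X v1 s \<union> U) h) = named X v1 s"
    using sub U unfolding fmdom'_restrict_set_precise by blast+
  ultimately show ?thesis using ag u unfolding mirrors_def by auto
qed

lemma mirrors_split: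
  assumes X: "finite X" and m: "mirrors X (b1 + b2) v s h" and c: "mcomp v1 v2 v"
  obtains h1 h2 where "hdisj h1 h2" "h = h1 ++\<^sub>f h2" "mirrors X b1 v1 s h1" "mirrors X b2 v2 s h2"
proof -
  have ag: "agrees X v s" "agrees X v1 s" "agrees X v2 s"
    using agrees_left[OF c] agrees_right[OF c] mirrors_agrees[OF m] by blast+
  obtain u1 u2 where u: "msize v1 = enat (card (named X v1 s)) + u1"
    "msize v2 = enat (card (named X v2 s)) + u2"
    using card_named_le[OF X] ag by (meson le_iff_add)
  have "card (named X v s) = card (named X v1 s) + card (named X v2 s)"
    unfolding named_mcomp[OF c]
    by (rule card_Un_disjoint) (simp_all add: finite_named X named_disjoint[OF c ag(1)])
  then have "msize v = enat (card (named X v s)) + (u1 + u2)"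
    using msize_add[OF c] u by (simp add: ac_simps flip: plus_enat_simps(1))
  \<comment> \<open>The witness in \<open>mirrors\<close> must be \<open>u1 + u2\<close>, because
    the finite number of named cells cancels.\<close>
  then have "approx (b1 + b2) (u1 + u2) (card (fmdom' h - s ` X))"
    using m unfolding mirrors_def by (metis enat_add_left_cancel enat.distinct(2))
  then obtain n1 n2 where n: "card (fmdom' h - s ` X) = n1 + n2" "approx b1 u1 n1" "approx b2 u2 n2"
    by (rule approx_split)
  have "n1 \<le> card (fmdom' h - s ` X)" using n by simp
  then obtain U where U: "U \<subseteq> fmdom' h - s ` X" "card U = n1" "finite U"
    by (rule obtain_subset_with_card_n)
  let ?V = "(fmdom' h - s ` X) - U"
  have V: "card ?V = n2" using n U by (simp add: card_Diff_subset)
  let ?h1 = "fmrestrict_set (named X v1 s \<union> U) h" and ?h2 = "fmrestrict_set (named X v2 s \<union> ?V) h"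
  have nd: "named X v1 s \<union> named X v2 s = s ` X \<inter> fmdom' h" "named X v1 s \<inter> named X v2 s = {}"
    using m named_mcomp[OF c, of X s] named_disjoint[OF c ag(1)] unfolding mirrors_def by blast+
  have "(D \<inter> (N1 \<union> U)) \<inter> (D \<inter> (N2 \<union> (D - S - U))) = {}"
    if "N1 \<union> N2 = S \<inter> D" "N1 \<inter> N2 = {}" "U \<subseteq> D - S" for D N1 N2 S
    using that by blast
  then have "hdisj ?h1 ?h2"
    unfolding hdisj_iff fmdom'_restrict_set_precise using nd U(1) by blast
  moreover have "h = ?h1 ++\<^sub>f ?h2"
  proof (rule fmap_ext)
    fix l
    have "l \<in> named X v2 s \<union> ?V \<or> l \<in> named X v1 s \<union> U" if "l \<in> fmdom' h" using nd that by blast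
    then show "fmlookup h l = fmlookup (?h1 ++\<^sub>f ?h2) l"
      by (cases "l \<in> fmdom' h") (auto simp: fmdom'_restrict_set_precise fmdom'_notD)
  qed
  moreover have "mirrors X b1 v1 s ?h1"
    by (rule mirrors_restrict[OF m c u(1)]) (use n U in auto)
  moreover have "mirrors X b2 v2 s ?h2"
    by (rule mirrors_restrict[OF m mcomp_comm[OF c] u(2)]) (use n V in auto)
  ultimately show thesis using that by blast
qed

section \<open>Realising a world by a heap\<close>

lemma ex_heap: "finite D \<Longrightarrow> \<exists>h. \<forall>l. fmlookup h l = (if l \<in> D then Some (f l) else None)"
proof (induction rule: finite_induct)
  case empty
  then show ?case by (intro exI[of _ fmempty]) simp
next
  case (insert d D)
  then obtain h where "\<forall>l. fmlookup h l = (if l \<in> D then Some (f l) else None)" by blast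
  then show ?case by (intro exI[of _ "fmupd d (f d) h"]) auto
qed

text \<open>The set \<open>F\<close> of forbidden addresses serves the wand case of the truth lemma,
  where the new heap must be disjoint from a given one.\<close>

lemma ex_mirrors:
  fixes s :: "'v \<Rightarrow> 'l::infinite"
  assumes X: "finite X" and F: "finite F" and ag: "agrees X v s" and dis: "named X v s \<inter> F = {}"
  obtains h where "mirrors X b v s h" "fmdom' h \<inter> F = {}"
proof -
  obtain u where u: "msize v = enat (card (named X v s)) + u"
    using card_named_le[OF X ag] by (meson le_iff_add)
  \<comment> \<open>An infinite surplus is represented by \<open>b\<close> cells, just enough to
    reach the threshold.\<close>
  define n where "n = (case u of enat n \<Rightarrow> n | \<infinity> \<Rightarrow> b)"
  have n: "approx b u n" by (auto simp: n_def approx_def split: enat.splits)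
  have "infinite (UNIV - (F \<union> s ` X))" using X F infinite_UNIV by (simp add: Diff_infinite_finite)
  then obtain B where B: "finite B" "card B = n" "B \<subseteq> UNIV - (F \<union> s ` X)"
    using infinite_arbitrarily_large by blast
  \<comment> \<open>A default content outside the image of \<open>X\<close>, for all cells that
    point to no variable in \<open>X\<close>.\<close>
  obtain d where d: "d \<notin> s ` X" using ex_new_if_finite[OF infinite_UNIV] X by blast
  define f where "f l = (if \<exists>x\<in>X. \<exists>y\<in>X. s x = l \<and> (x \<hookrightarrow> y) \<in> v
     then SOME k. \<exists>x\<in>X. \<exists>y\<in>X. s x = l \<and> s y = k \<and> (x \<hookrightarrow> y) \<in> v else d)" for l
  obtain h where h: "\<And>l. fmlookup h l = (if l \<in> named X v s \<union> B then Some (f l) else None)"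
    using ex_heap[of "named X v s \<union> B" f] finite_named[OF X] B(1) by auto
  have dom: "fmdom' h = named X v s \<union> B"
    unfolding dom_fmlookup[symmetric] dom_def h by (auto split: if_splits)
  note mv = agrees_mcs[OF ag]
  have cong: "(x \<hookrightarrow> y) \<in> v"
    if h: "(x' \<hookrightarrow> y') \<in> v" "s x' = s x" "s y' = s y" "x \<in> X" "y \<in> X" "x' \<in> X" "y' \<in> X" for x x' y y'
  proof -
    have "(x' \<^bold>= x) \<in> v" "(y' \<^bold>= y) \<in> v" using ag h unfolding agrees_def by blast+
    then show ?thesis using mcs_points_to_cong[OF mv] h(1) by blast
  qed
  have "(x \<hookrightarrow> y) \<in> v \<longleftrightarrow> fmlookup h (s x) = Some (s y)" if xy: "x \<in> X" "y \<in> X" for x y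
  proof
    assume p: "(x \<hookrightarrow> y) \<in> v"
    let ?P = "\<lambda>k. \<exists>x'\<in>X. \<exists>y'\<in>X. s x' = s x \<and> s y' = k \<and> (x' \<hookrightarrow> y') \<in> v"
    have "?P (s y)" using p xy by blast
    moreover have "k = s y" if "?P k" for k
    proof -
      from that obtain x' y' where h: "x' \<in> X" "y' \<in> X" "s x' = s x" "s y' = k" "(x' \<hookrightarrow> y') \<in> v" by blast
      then have "(x \<hookrightarrow> y') \<in> v" using cong xy by metis
      then have "(y' \<^bold>= y) \<in> v" using mcs_points_to_fun[OF mv] p by blast
      then show ?thesis using ag h xy unfolding agrees_def by blast
    qed
    ultimately have "(SOME k. ?P k) = s y" by (rule some_equality)
    then have "f (s x) = s y" using p xy unfolding f_def by auto
    then show "fmlookup h (s x) = Some (s y)" unfolding h using points_to_imp_named[OF mv xy(1) p, of s] by simp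
  next
    assume "fmlookup h (s x) = Some (s y)"
    then have "f (s x) = s y" unfolding h by (auto split: if_splits)
    then have ex: "\<exists>x'\<in>X. \<exists>y'\<in>X. s x' = s x \<and> (x' \<hookrightarrow> y') \<in> v"
      using d xy unfolding f_def by (metis imageI)
    then have "\<exists>k. \<exists>x'\<in>X. \<exists>y'\<in>X. s x' = s x \<and> s y' = k \<and> (x' \<hookrightarrow> y') \<in> v" by blast
    from someI_ex[OF this] have "\<exists>x'\<in>X. \<exists>y'\<in>X. s x' = s x \<and> s y' = f (s x) \<and> (x' \<hookrightarrow> y') \<in> v"
      using ex unfolding f_def by simp
    then show "(x \<hookrightarrow> y) \<in> v" using \<open>f (s x) = s y\<close> cong xy by metis
  qed
  moreover have "fmdom' h - s ` X = B" "s ` X \<inter> fmdom' h = named X v s"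
    using B named_subset[of X v s] unfolding dom by blast+
  ultimately have "mirrors X b v s h" unfolding mirrors_def using ag u n B(2) by auto
  moreover have "fmdom' h \<inter> F = {}" using B(3) dis dom by blast
  ultimately show thesis using that by blast
qed

lemma mirrors_cell_named:
  assumes ag: "agrees X c s" and x: "x \<in> X" "alloc x \<in> c" and sz: "msize c = 1"
    and pt: "\<And>z. z \<in> X \<Longrightarrow> (x \<hookrightarrow> z) \<in> c \<longleftrightarrow> l = s z"
  shows "mirrors X b c s (fmupd (s x) l fmempty)"
proof -
  note m = agrees_mcs[OF ag]
  have nm: "named X c s = {s x}" by (rule named_single[OF ag x sz])
  have "(y \<hookrightarrow> z) \<in> c \<longleftrightarrow> fmlookup (fmupd (s x) l fmempty) (s y) = Some (s z)"
    if yz: "y \<in> X" "z \<in> X" for y z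
  proof (cases "s y = s x")
    case True
    then have "(y \<^bold>= x) \<in> c" using ag x(1) yz(1) unfolding agrees_def by blast
    then have "(y \<hookrightarrow> z) \<in> c \<longleftrightarrow> (x \<hookrightarrow> z) \<in> c"
      using mcs_points_to_cong[OF m _ mcs_eq_refl[OF m]] by blast
    then show ?thesis using True pt[OF yz(2)] by simp
  next
    case False
    then show ?thesis using points_to_imp_named[OF m yz(1), of z s] nm by auto
  qed
  then show ?thesis
    unfolding mirrors_def nm using ag sz x(1)
    by (auto simp: one_enat_def approx_def enat_0 intro!: exI[of _ 0])
qed

lemma mirrors_cell_unnamed:
  assumes ag: "agrees X c s" and no: "\<And>x. x \<in> X \<Longrightarrow> alloc x \<notin> c" and sz: "msize c = 1"
    and l: "l \<notin> s ` X"
  shows "mirrors X b c s (fmupd l k fmempty)"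
proof -
  have nm: "named X c s = {}" using no by (auto simp: named_def)
  have "(y \<hookrightarrow> z) \<notin> c" if "y \<in> X" for y z
    using points_to_imp_named[OF agrees_mcs[OF ag] that, of z s] nm by blast
  moreover have "fmdom' (fmupd l k fmempty) - s ` X = {l}" using l by auto
  ultimately show ?thesis
    unfolding mirrors_def nm using ag sz l
    by (auto simp: one_enat_def approx_def enat_0 image_iff intro!: exI[of _ 1])
qed

text \<open>The cases are the three extension axioms: named address with named content, named
  address with other content, and unnamed address. In the last one \<open>k\<close> is arbitrary, as
  \<open>mirrors\<close> does not record the content of such a cell.\<close>

lemma mirrors_extend_cell:
  assumes X: "finite X" and m: "mirrors X b v s h" and l: "l \<notin> fmdom' h"
  obtains c w where "mcomp v c w" "mirrors X b c s (fmupd l k fmempty)"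
proof (cases "l \<in> s ` X")
  case True
  then obtain x where x: "x \<in> X" "l = s x" by blast
  note ag = mirrors_agrees[OF m]
  note mv = agrees_mcs[OF ag]
  have al: "alloc x \<notin> v"
    using in_named[OF ag x(1)] m l x(2) unfolding mirrors_def by blast
  show thesis
  proof (cases "k \<in> s ` X")
    case True
    then obtain y where y: "y \<in> X" "k = s y" by blast
    obtain c w where c: "mcomp v c w" "msize c = 1" "(x \<hookrightarrow> y) \<in> c"
      using mcs_extend_points_to[OF mv al] .
    have agc: "agrees X c s" using ag agrees_left[OF c(1)] agrees_right[OF c(1)] by blast
    note mc = agrees_mcs[OF agc]
    have "(x \<hookrightarrow> z) \<in> c \<longleftrightarrow> s y = s z" if z: "z \<in> X" for z
    proof -
      have "(x \<hookrightarrow> z) \<in> c \<longleftrightarrow> (y \<^bold>= z) \<in> c"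
        using mcs_points_to_fun[OF mc c(3), of z] mcs_points_to_cong[OF mc mcs_eq_refl[OF mc], of y z x] c(3)
        by blast
      then show ?thesis using agc y(1) z unfolding agrees_def by blast
    qed
    then have "mirrors X b c s (fmupd (s x) (s y) fmempty)"
      by (rule mirrors_cell_named[OF agc x(1) mcs_points_to_alloc[OF mc c(3)] c(2)])
    then show thesis using that[OF c(1)] x(2) y(2) by simp
  next
    case False
    obtain c w where c: "mcomp v c w" "msize c = 1" "alloc x \<in> c" "\<And>y. y \<in> X \<Longrightarrow> (x \<hookrightarrow> y) \<notin> c"
      by (rule mcs_extend_alloc[OF mv al X]) blast
    have agc: "agrees X c s" using ag agrees_left[OF c(1)] agrees_right[OF c(1)] by blast
    have "mirrors X b c s (fmupd (s x) k fmempty)"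
      by (rule mirrors_cell_named[OF agc x(1) c(3,2)]) (use c(4) False in auto)
    then show thesis using that[OF c(1)] x(2) by simp
  qed
next
  case False
  note ag = mirrors_agrees[OF m]
  obtain c w where c: "mcomp v c w" "msize c = 1" "\<And>x. x \<in> X \<Longrightarrow> alloc x \<notin> c"
    by (rule mcs_extend_fresh[OF agrees_mcs[OF ag] X]) blast
  have agc: "agrees X c s" using ag agrees_left[OF c(1)] agrees_right[OF c(1)] by blast
  show thesis by (rule that[OF c(1) mirrors_cell_unnamed[OF agc c(3,2) False]])
qed

lemma mirrors_empty:
  assumes ag: "agrees X v s" and e: "Emp \<in> v" and X: "finite X"
  shows "mirrors X b v s fmempty"
proof -
  have 0: "msize v = 0" using msize_eq_0[OF agrees_mcs[OF ag]] e by blast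
  have "enat (card (named X v s)) \<le> 0" using card_named_le[OF X ag] 0 by simp
  then have nm: "named X v s = {}" using finite_named[OF X, of v s] by (simp add: zero_enat_def)
  then have "(x \<hookrightarrow> y) \<notin> v" if "x \<in> X" for x y
    using points_to_imp_named[OF agrees_mcs[OF ag] that, of y s] by blast
  then show ?thesis
    using ag 0 nm unfolding mirrors_def approx_def by (auto simp: enat_0)
qed

text \<open>Associativity merges each new cell with the world of the cells added so far, and
  \<open>mirrors_add\<close> then covers the extended heap.\<close>

lemma mirrors_extend:
  assumes X: "finite X" and m: "mirrors X b v s h" and d: "hdisj h1 h"
  shows "\<exists>v1 w. mcomp v v1 w \<and> mirrors X b v1 s h1 \<and> mirrors X b w s (h ++\<^sub>f h1)"
  using d
proof (induction h1 rule: fmap_induct)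
  case fmempty
  note ag = mirrors_agrees[OF m]
  obtain e where e: "mcomp v e v" "Emp \<in> e" using mcomp_unit[OF agrees_mcs[OF ag]] .
  have "agrees X e s" using agrees_right[OF e(1)] ag by blast
  then show ?case using e m mirrors_empty[OF _ e(2) X] by auto
next
  case (fmupd l k h1)
  have l: "l \<notin> fmdom' h1" using fmupd.hyps by (simp add: fmlookup_dom'_iff)
  have d: "hdisj h1 h" "l \<notin> fmdom' h" using fmupd.prems by (auto simp: hdisj_iff)
  obtain v1 w where vw: "mcomp v v1 w" "mirrors X b v1 s h1" "mirrors X b w s (h ++\<^sub>f h1)"
    using fmupd.IH[OF d(1)] by blast
  have "l \<notin> fmdom' (h ++\<^sub>f h1)" using l d by simp
  then obtain c w' where c: "mcomp w c w'" "mirrors X b c s (fmupd l k fmempty)"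
    using mirrors_extend_cell[OF X vw(3)] by blast
  obtain f where f: "mcomp v1 c f" "mcomp v f w'" using mcomp_assoc[OF vw(1) c(1)] .
  have "hdisj h1 (fmupd l k fmempty)" using l by (auto simp: hdisj_iff)
  from mirrors_add[OF X f(1) this vw(2) c(2)]
  have mf: "mirrors X b f s (fmupd l k h1)" by simp
  have "hdisj h (fmupd l k h1)" using fmupd.prems hdisj_comm by blast
  from mirrors_add[OF X f(2) this m mf] show ?case using f(2) mf by blast
qed

text \<open>A named cell must go to the side that owns its address: it is detached from
  \<open>v\<close>, the rest is split by induction, and the cell is joined to the factor on that
  side. Without named cells only counts are left, which is
  \<open>approx_split_right\<close>.\<close>

lemma mirrors_unsplit:
  assumes X: "finite X" and m: "mirrors X (b1 + b2) v s (h1 ++\<^sub>f h2)" and d: "hdisj h1 h2"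
  shows "\<exists>v1 v2. mcomp v1 v2 v \<and> mirrors X b1 v1 s h1 \<and> mirrors X b2 v2 s h2"
  using m d
proof (induction "card (named X v s)" arbitrary: v h1 h2 b1 b2)
  case 0
  note ag = mirrors_agrees[OF "0.prems"(1)]
  have nm: "named X v s = {}" using 0(1) finite_named[OF X, of v s] by simp
  then have dom: "s ` X \<inter> fmdom' h1 = {}" "s ` X \<inter> fmdom' h2 = {}"
    using "0.prems"(1) unfolding mirrors_def by auto
  have part: "mirrors X b u s k"
    if u: "agrees X u s" "named X u s = {}" and k: "s ` X \<inter> fmdom' k = {}"
      and a: "approx b (msize u) (card (fmdom' k))" for b u k
  proof -
    have "fmdom' k - s ` X = fmdom' k" using k by blast
    moreover have "fmlookup k (s x) = None" if "x \<in> X" for x using k that by (auto intro: fmdom'_notD)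
    moreover have "(x \<hookrightarrow> y) \<notin> u" if "x \<in> X" for x y
      using points_to_imp_named[OF agrees_mcs[OF u(1)] that, of y s] u(2) by blast
    ultimately show ?thesis using u k a unfolding mirrors_def by (auto simp: zero_enat_def[symmetric])
  qed
  have parts: "mirrors X c1 v1 s k1 \<and> mirrors X c2 v2 s k2"
    if c: "mcomp v1 v2 v" and "approx c1 (msize v1) (card (fmdom' k1))" "approx c2 (msize v2) (card (fmdom' k2))"
      "s ` X \<inter> fmdom' k1 = {}" "s ` X \<inter> fmdom' k2 = {}" for v1 v2 c1 c2 k1 k2
  proof -
    have "agrees X v1 s" "agrees X v2 s" using agrees_left[OF c] agrees_right[OF c] ag by blast+
    moreover have "named X v1 s = {}" "named X v2 s = {}" using named_mcomp[OF c, of X s] nm by auto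
    ultimately show ?thesis using part that by blast
  qed
  have "fmdom' (h1 ++\<^sub>f h2) - s ` X = fmdom' h1 \<union> fmdom' h2" using dom by auto
  then have "card (fmdom' (h1 ++\<^sub>f h2) - s ` X) = card (fmdom' h1) + card (fmdom' h2)"
    using card_hadd[OF "0.prems"(2)] by simp
  then have "approx (b1 + b2) (msize v) (card (fmdom' h1) + card (fmdom' h2))"
    using "0.prems"(1) unfolding mirrors_def nm by (auto simp: zero_enat_def[symmetric])
  then show ?case
  proof (cases rule: approx_split_right)
    case (1 m)
    obtain c w where c: "mcomp c w v" "msize c = enat m"
      using mcs_split_size[OF agrees_mcs[OF ag] 1(1)] .
    then show ?thesis using 1(2) msize_add[OF c(1)] parts[OF c(1) _ _ dom] by metis
  next
    case (2 m)
    obtain c w where c: "mcomp c w v" "msize c = enat m"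
      using mcs_split_size[OF agrees_mcs[OF ag] 2(1)] .
    then show ?thesis using 2(2) msize_add[OF c(1)] parts[OF c(1) _ _ dom(2,1)] mcomp_comm[OF c(1)] by metis
  qed
next
  case (Suc n)
  note ag = mirrors_agrees[OF Suc.prems(1)]
  have "named X v s \<noteq> {}" using Suc.hyps(2) by auto
  then obtain x where x: "x \<in> X" "alloc x \<in> v" by (auto simp: named_def)
  obtain c w where c: "mcomp c w v" "alloc x \<in> c" "msize c = 1"
    using mcs_split_alloc[OF agrees_mcs[OF ag] x(2)] .
  have ags: "agrees X c s" "agrees X w s" using agrees_left[OF c(1)] agrees_right[OF c(1)] ag by blast+
  have nc: "named X c s = {s x}" by (rule named_single[OF ags(1) x(1) c(2,3)])
  have nv: "named X v s = insert (s x) (named X w s)" "s x \<notin> named X w s"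
    using named_mcomp[OF c(1), of X s] named_disjoint[OF c(1) ag] nc by auto
  then have cv: "card (named X v s) = Suc (card (named X w s))" by (simp add: finite_named X)
  have sx: "s x \<in> named X v s" using nv by simp
  \<comment> \<open>Stated for arbitrary bounds and heaps, so that exchanging the two sides covers
    the case that \<open>h2\<close> owns \<open>s x\<close>.\<close>
  have step: "\<exists>v1 v2. mcomp v1 v2 v \<and> mirrors X b1 v1 s h1 \<and> mirrors X b2 v2 s h2"
    if m: "mirrors X (b1 + b2) v s (h1 ++\<^sub>f h2)" and d: "hdisj h1 h2" and l: "s x \<in> fmdom' h1"
    for b1 b2 h1 h2
  proof -
    let ?h = "h1 ++\<^sub>f h2" and ?k = "fmrestrict_set {s x} h1" and ?g = "fmrestrict_set (- {s x}) h1"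
    \<comment> \<open>The detached cell has no anonymous part: surplus 0 and an empty
      \<open>U\<close> match exactly, whatever the bound.\<close>
    have "mirrors X b1 c s (fmrestrict_set (named X c s \<union> {}) ?h)"
      by (rule mirrors_restrict[OF m c(1), where u = 0])
        (simp_all add: nc c(3) one_enat_def approx_def zero_enat_def)
    moreover have "fmrestrict_set (named X c s \<union> {}) ?h = ?k"
      using l d unfolding nc by (intro fmap_ext) (auto simp: hdisj_iff fmdom'_restrict_set_precise)
    ultimately have mk: "mirrors X b1 c s ?k" by simp
    obtain u where u: "msize v = enat (card (named X v s)) + u" "approx (b1 + b2) u (card (fmdom' ?h - s ` X))"
      using m unfolding mirrors_def by blast
    have "msize w = enat (card (named X w s)) + u"
      \<comment> \<open>Size and number of named cells both drop by one, so the surplus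
        \<open>u\<close>, and with it the full bound, passes to \<open>w\<close>.\<close>
      using u(1) msize_add[OF c(1)] c(3) cv by (cases u; cases "msize w") (auto simp: one_enat_def)
    then have "mirrors X (b1 + b2) w s (fmrestrict_set (named X w s \<union> (fmdom' ?h - s ` X)) ?h)"
      by (rule mirrors_restrict[OF m mcomp_comm[OF c(1)] _ u(2)]) simp
    moreover have "fmrestrict_set (named X w s \<union> (fmdom' ?h - s ` X)) ?h = ?g ++\<^sub>f h2"
    proof (rule fmap_ext)
      fix l'
      have "insert (s x) (named X w s) = s ` X \<inter> fmdom' ?h" using m nv unfolding mirrors_def by blast
      then have mem: "l' \<in> named X w s \<union> (fmdom' ?h - s ` X) \<longleftrightarrow> l' \<in> fmdom' ?h \<and> l' \<noteq> s x"
        using nv(2) x(1) by blast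
      have "s x \<notin> fmdom' h2" using d l by (auto simp: hdisj_iff)
      then show "fmlookup (fmrestrict_set (named X w s \<union> (fmdom' ?h - s ` X)) ?h) l' = fmlookup (?g ++\<^sub>f h2) l'"
        unfolding fmlookup_restrict_set mem by (cases "l' = s x") (auto simp: fmdom'_notD)
    qed
    ultimately have "mirrors X (b1 + b2) w s (?g ++\<^sub>f h2)" by simp
    moreover have dg: "hdisj ?g h2" using d by (auto simp: hdisj_iff fmdom'_restrict_set_precise)
    moreover have "n = card (named X w s)" using cv Suc.hyps(2) by simp
    ultimately obtain w1 w2 where w: "mcomp w1 w2 w" "mirrors X b1 w1 s ?g" "mirrors X b2 w2 s h2"
      using Suc.hyps(1) by blast
    obtain f where f: "mcomp w1 c f" "mcomp w2 f v"
      using mcomp_assoc[OF mcomp_comm[OF w(1)] mcomp_comm[OF c(1)]] .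
    have "mirrors X b1 f s (?k ++\<^sub>f ?g)"
      by (rule mirrors_add[OF X mcomp_comm[OF f(1)] hsplit(2) mk w(2)])
    then have "mirrors X b1 f s h1" using hsplit(1)[of h1 "{s x}"] by simp
    then show ?thesis using mcomp_comm[OF f(2)] w(3) by blast
  qed
  have "s x \<in> fmdom' h1 \<or> s x \<in> fmdom' h2" using sx Suc.prems(1) unfolding mirrors_def by auto
  then show ?case
  proof
    assume "s x \<in> fmdom' h1"
    then show ?thesis by (rule step[OF Suc.prems])
  next
    assume l: "s x \<in> fmdom' h2"
    have "mirrors X (b2 + b1) v s (h2 ++\<^sub>f h1)"
      using Suc.prems(1) by (simp only: add.commute[of b2] hadd_comm[OF Suc.prems(2)])
    then have "\<exists>v1 v2. mcomp v1 v2 v \<and> mirrors X b2 v1 s h2 \<and> mirrors X b1 v2 s h1"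
      using Suc.prems(2) hdisj_comm l by (intro step) blast+
    then show ?thesis using mcomp_comm by blast
  qed
qed

section \<open>The truth lemma and completeness\<close>

text \<open>The threshold required by the truth lemma. \<open>Emp\<close> has to tell 0 from 1; the
  factors of a star share the bound, so their ranks add; the other connectives hand it on
  whole.\<close>

fun srank :: "'v form \<Rightarrow> nat" where
  "srank (x \<^bold>= y) = 0"
| "srank (x \<hookrightarrow> y) = 0"
| "srank Emp = 1"
| "srank (\<^bold>\<not> \<phi>) = srank \<phi>"
| "srank (\<phi> \<^bold>\<and> \<psi>) = max (srank \<phi>) (srank \<psi>)"
| "srank (\<phi> \<^bold>* \<psi>) = srank \<phi> + srank \<psi>"
| "srank (\<phi> \<^bold>-\<^bold>* \<psi>) = max (srank \<phi>) (srank \<psi>)"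

lemma approx_1: "approx 1 u n \<Longrightarrow> u = 0 \<longleftrightarrow> n = 0"
  by (cases u) (auto simp: approx_def zero_enat_def)

lemma mirrors_Emp:
  assumes X: "finite X" and m: "mirrors X 1 v s h"
  shows "Emp \<in> v \<longleftrightarrow> fmdom' h = {}"
proof -
  obtain u where u: "msize v = enat (card (named X v s)) + u" "approx 1 u (card (fmdom' h - s ` X))"
    and nm: "named X v s = s ` X \<inter> fmdom' h"
    using m unfolding mirrors_def by blast
  have "Emp \<in> v \<longleftrightarrow> named X v s = {} \<and> u = 0"
    using msize_eq_0[OF agrees_mcs[OF mirrors_agrees[OF m]]] u(1) finite_named[OF X, of v s]
    by (cases u) (auto simp: zero_enat_def)
  also have "u = 0 \<longleftrightarrow> fmdom' h - s ` X = {}"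
    using approx_1[OF u(2)] by simp
  finally show ?thesis using nm by blast
qed

lemma truth:
  fixes s :: "'v \<Rightarrow> 'l::infinite"
  assumes X: "finite X" and "set_form \<phi> \<subseteq> X" "srank \<phi> \<le> b" "mirrors X b v s h"
  shows "\<phi> \<in> v \<longleftrightarrow> sat s h \<phi>"
  using assms(2-)
proof (induction \<phi> arbitrary: b v h)
  case (Eq x y)
  then show ?case by (auto simp: mirrors_def agrees_def)
next
  case (PointsTo x y)
  then show ?case by (simp add: mirrors_def)
next
  case Emp
  then show ?case using mirrors_Emp[OF X mirrors_mono] by (simp add: fmdom_empty_iff)
next
  case (Neg \<phi>)
  then show ?case using agrees_mcs[OF mirrors_agrees[OF Neg.prems(3)]] by simp
next
  case (Conj \<phi> \<psi>)
  then show ?case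
    using agrees_mcs[OF mirrors_agrees[OF Conj.prems(3)]] Conj.IH(1)[OF _ _ Conj.prems(3)]
      Conj.IH(2)[OF _ _ Conj.prems(3)] by simp
next
  case (Star \<phi> \<psi>)
  \<comment> \<open>Lowering the bound to the exact sum lets it be divided into the ranks of the two
    factors.\<close>
  have m: "mirrors X (srank \<phi> + srank \<psi>) v s h" by (rule mirrors_mono[OF Star.prems(3)]) (use Star.prems in simp)
  note IH = Star.IH(1)[OF _ order_refl] Star.IH(2)[OF _ order_refl]
  have sub: "set_form \<phi> \<subseteq> X" "set_form \<psi> \<subseteq> X" using Star.prems by auto
  show ?case
  proof
    assume "(\<phi> \<^bold>* \<psi>) \<in> v"
    then obtain v1 v2 where c: "mcomp v1 v2 v" "\<phi> \<in> v1" "\<psi> \<in> v2"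
      by (rule mcs_starE[OF agrees_mcs[OF mirrors_agrees[OF m]]])
    obtain h1 h2 where "hdisj h1 h2" "h = h1 ++\<^sub>f h2" "mirrors X (srank \<phi>) v1 s h1" "mirrors X (srank \<psi>) v2 s h2"
      using mirrors_split[OF X m c(1)] .
    then show "sat s h (\<phi> \<^bold>* \<psi>)" using IH sub c unfolding sat.simps by blast
  next
    assume "sat s h (\<phi> \<^bold>* \<psi>)"
    then obtain h1 h2 where h: "hdisj h1 h2" "h = h1 ++\<^sub>f h2" "sat s h1 \<phi>" "sat s h2 \<psi>" by auto
    then obtain v1 v2 where "mcomp v1 v2 v" "mirrors X (srank \<phi>) v1 s h1" "mirrors X (srank \<psi>) v2 s h2"
      using mirrors_unsplit[OF X, of _ _ v s h1 h2] m by blast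
    then show "(\<phi> \<^bold>* \<psi>) \<in> v" using mcomp_star IH sub h by blast
  qed
next
  case (Wand \<phi> \<psi>)
  note m = Wand.prems(3)
  have IH: "mirrors X b u s k \<Longrightarrow> \<phi> \<in> u \<longleftrightarrow> sat s k \<phi>" "mirrors X b u s k \<Longrightarrow> \<psi> \<in> u \<longleftrightarrow> sat s k \<psi>" for u k
    using Wand.IH(1)[of b u k] Wand.IH(2)[of b u k] Wand.prems by auto
  show ?case
  proof
    assume w: "(\<phi> \<^bold>-\<^bold>* \<psi>) \<in> v"
    have "sat s (h ++\<^sub>f h1) \<psi>" if d: "hdisj h1 h" and h1: "sat s h1 \<phi>" for h1
    proof -
      obtain v1 u where "mcomp v v1 u" "mirrors X b v1 s h1" "mirrors X b u s (h ++\<^sub>f h1)"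
        using mirrors_extend[OF X m d] by blast
      then show ?thesis using mcomp_wand[of v v1 u] w IH h1 by blast
    qed
    then show "sat s h (\<phi> \<^bold>-\<^bold>* \<psi>)" by simp
  next
    assume sat: "sat s h (\<phi> \<^bold>-\<^bold>* \<psi>)"
    show "(\<phi> \<^bold>-\<^bold>* \<psi>) \<in> v"
    proof (rule ccontr)
      assume "(\<phi> \<^bold>-\<^bold>* \<psi>) \<notin> v"
      then obtain v1 u where c: "mcomp v v1 u" "\<phi> \<in> v1" "\<psi> \<notin> u"
        by (rule mcs_not_wandE[OF agrees_mcs[OF mirrors_agrees[OF m]]])
      have ag: "agrees X u s" "agrees X v1 s"
        using mirrors_agrees[OF m] agrees_left[OF c(1)] agrees_right[OF c(1)] by blast+
      have nm: "named X v s = s ` X \<inter> fmdom' h" using m by (simp add: mirrors_def)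
      \<comment> \<open>A clash would be a named location allocated by both \<open>v\<close> and
        \<open>v1\<close>.\<close>
      have "named X v1 s \<inter> fmdom' h = {}"
        using named_disjoint[OF c(1) ag(1)] named_subset[of X v1 s] unfolding nm by blast
      then obtain h1 where h1: "mirrors X b v1 s h1" "fmdom' h1 \<inter> fmdom' h = {}"
        using ex_mirrors[OF X finite_fmdom' ag(2)] by blast
      have d: "hdisj h h1" "hdisj h1 h" using h1(2) by (auto simp: hdisj_iff)
      have "sat s h1 \<phi>" using IH(1)[OF h1(1)] c(2) by blast
      then have "sat s (h ++\<^sub>f h1) \<psi>" using sat d(2) by simp
      then show False using IH(2)[OF mirrors_add[OF X c(1) d(1) m h1(1)]] c(3) by blast
    qed
  qed
qed

text \<open>Each class of variables equal in \<open>v\<close> gets its own location, through a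
  chosen representative and an injection of the countably many variables into the locations.\<close>

lemma ex_agrees:
  fixes v :: "'v::countable form set"
  assumes v: "mcs v"
  obtains s :: "'v \<Rightarrow> 'l::infinite" where "agrees UNIV v s"
proof -
  obtain f :: "nat \<Rightarrow> 'l" where f: "inj f"
    using infinite_countable_subset[OF infinite_UNIV] by blast
  define r where "r x = (SOME y. (x \<^bold>= y) \<in> v)" for x
  have r: "(x \<^bold>= r x) \<in> v" for x
    unfolding r_def by (rule someI[of _ x]) (rule mcs_eq_refl[OF v])
  have "(x \<^bold>= y) \<in> v \<longleftrightarrow> f (to_nat (r x)) = f (to_nat (r y))" for x y
  proof
    assume "(x \<^bold>= y) \<in> v"
    \<comment> \<open>Equal variables give the same predicate, and so the same choice of
      representative.\<close>
    then have "(x \<^bold>= z) \<in> v \<longleftrightarrow> (y \<^bold>= z) \<in> v" for z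
      using mcs_eq_trans[OF v] mcs_eq_sym[OF v] by blast
    then show "f (to_nat (r x)) = f (to_nat (r y))" by (simp add: r_def)
  next
    assume "f (to_nat (r x)) = f (to_nat (r y))"
    then have "r x = r y" using f by (simp add: inj_eq)
    then show "(x \<^bold>= y) \<in> v" using r[of x] r[of y] mcs_eq_trans[OF v] mcs_eq_sym[OF v] by metis
  qed
  then have "agrees UNIV v (\<lambda>x. f (to_nat (r x)))" using v by (simp add: agrees_def)
  then show thesis by (rule that)
qed

theorem theorem6p5:
  fixes \<phi> :: "'v::{countable, infinite} form"
  shows "valid TYPE('l::{countable, infinite}) \<phi> \<longleftrightarrow> derivable \<phi>"
proof
  assume val: "valid TYPE('l) \<phi>"
  show "\<turnstile> \<phi>"
    unfolding derivable_iff_mcs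
  proof (intro allI impI)
    fix v :: "'v form set" assume v: "mcs v"
    obtain s :: "'v \<Rightarrow> 'l" where "agrees UNIV v s" using ex_agrees[OF v] .
    then have ag: "agrees (set_form \<phi>) v s" by (simp add: agrees_def)
    have fin: "finite (set_form \<phi>)" by (induction \<phi>) auto
    obtain h where "mirrors (set_form \<phi>) (srank \<phi>) v s h"
      using ex_mirrors[OF fin finite.emptyI ag] by auto
    then show "\<phi> \<in> v" using truth[OF fin order_refl order_refl] val unfolding valid_def by blast
  qed
qed (simp add: valid_def soundness)

end
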